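(* Let $(E,C)$ be a separated graph with $E^0,E^1$ countable, in which all edges have the same source $v_0$, the range map is injective and $E$ has no loops; let $S\subseteq C_{fin}$ and $K$ a field. Then the representation $\pi:AL_K(E,C,S)\to\mathrm{Hom}_K(M)$ arising from a branching system obtained by the construction described in the context is faithful (injective).
   Context: A separated graph is a pair $(E,C)$ where $E=(E^0,E^1,r,s)$ is a directed graph and $C=\bigcup_{v\in E^0}C_v$, where for each non-sink $v$, $C_v$ is a partition of $s^{-1}(v)$ into pairwise disjoint nonempty sets; $C_{fin}$ is the set of finite $Y\in C$. The Cohn-Leavitt algebra $L_K(E,C,S)$ is the universal $K$-algebra generated by pairwise orthogonal idempotents $\{v:v\in E^0\}$ and elements $\{e,e^*:e\in E^1\}$ subject to: $s(e)e=er(e)=e$; $r(e)e^*=e^*s(e)=e^*$; $e^*f=\delta_{e,f}r(e)$ for $e,f\in Y$, $Y\in C$; $v=\sum_{e\in X}ee^*$ for every $X\in S\cap C_v$, $v$ non-sink. The abelianized Cohn-Leavitt algebra $AL_K(E,C,S)$ is the quotient of $L_K(E,C,S)$ by the ideal generated by all $\lambda\lambda^*\beta\beta^*-\beta\beta^*\lambda\lambda^*$ with $\lambda,\beta$ in the multiplicative semigroup generated by $E^1\cup(E^1)^*$. Construction of the branching system: enumerate $E^0=\{w_0,w_1,\dots\}$ and put $D_{w_i}=[i,i+1)\subseteq\mathbb{R}$, $\mathfrak{X}=\bigcup_i D_{w_i}$. For each non-sink $v$ enumerate $C_v=\{Y_1,Y_2,\dots\}$ and let $\widetilde{Y_j}=Y_j\cup\{\text{one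 extra symbol}\}$ if $Y_j\notin S$ and $\widetilde{Y_j}=Y_j$ if $Y_j\in S$. Partition $D_v$ into $|\widetilde{Y_1}|$ left-closed right-open intervals indexed by $\widetilde{Y_1}$, and for $e\in Y_1$ let $R_e$ be the interval indexed by $e$. Inductively, given the (countable) partition of $D_v$ into left-closed right-open intervals obtained at stage $n$, partition each of its intervals into $|\widetilde{Y_{n+1}}|$ left-closed right-open intervals indexed by $\widetilde{Y_{n+1}}$, and for $e\in Y_{n+1}$ let $R_e$ be the union of all subintervals indexed by $e$. For each $e\in E^1$, $R_e$ is a disjoint union of countably many left-closed right-open intervals $\{J_k\}_{k\in\Delta}$; partition $D_{r(e)}$ into $|\Delta|$ left-closed right-open intervals $\{D_k\}_{k\in\Delta}$, choose bijections $D_k\to J_k$, and let $f_e:D_{r(e)}\to R_e$ be the resulting bijection. $M$ is the $K$-module of all functions $\mathfrak{X}\to K$, and $\pi$ is the algebra homomorphism (well defined on $AL_K(E,C,S)$) determined by $\pi(v)\phi=\chi_{D_v}\phi$, $\pi(e)\phi=$ the function equal to $\phi(f_e^{-1}(x))$ on $R_e$ and $0$ elsewhere, $\pi(e^* )\phi=$ the function equal to $\phi(f_e(x))$ on $D_{r(e)}$ and $0$ elsewhere. *)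

theory Defs
  imports Complex_Main "HOL-Library.Countable_Set"
begin

definition graph :: "'v set \<Rightarrow> 'e set \<Rightarrow> ('e \<Rightarrow> 'v) \<Rightarrow> ('e \<Rightarrow> 'v) \<Rightarrow> bool" where
  "graph E0 E1 r s \<longleftrightarrow> (\<forall>e\<in>E1. s e \<in> E0 \<and> r e \<in> E0)"

definition is_sink :: "'e set \<Rightarrow> ('e \<Rightarrow> 'v) \<Rightarrow> 'v \<Rightarrow> bool" where
  "is_sink E1 s v \<longleftrightarrow> (\<forall>e\<in>E1. s e \<noteq> v)"

definition Cv :: "'e set set \<Rightarrow> 'e set \<Rightarrow> ('e \<Rightarrow> 'v) \<Rightarrow> 'v \<Rightarrow> 'e set set" where
  "Cv C E1 s v = {X \<in> C. X \<subseteq> {e \<in> E1. s e = v}}"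

definition separated_graph ::
  "'v set \<Rightarrow> 'e set \<Rightarrow> ('e \<Rightarrow> 'v) \<Rightarrow> ('e \<Rightarrow> 'v) \<Rightarrow> 'e set set \<Rightarrow> bool" where
  "separated_graph E0 E1 r s C \<longleftrightarrow> graph E0 E1 r s \<and>
     C = (\<Union>v\<in>E0. Cv C E1 s v) \<and>
     (\<forall>v\<in>E0. \<not> is_sink E1 s v \<longrightarrow>
        (\<forall>X\<in>Cv C E1 s v. X \<noteq> {}) \<and>
        (\<forall>X\<in>Cv C E1 s v. \<forall>Y\<in>Cv C E1 s v. X \<noteq> Y \<longrightarrow> X \<inter> Y = {}) \<and>
        \<Union>(Cv C E1 s v) = {e \<in> E1. s e = v}) \<and>
     (\<forall>v\<in>E0. is_sink E1 s v \<longrightarrow> Cv C E1 s v = {})"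

definition C_fin :: "'e set set \<Rightarrow> 'e set set" where
  "C_fin C = {Y \<in> C. finite Y}"

datatype ('v, 'e) gen = GV 'v | GE 'e | GS 'e

definition valid_gen :: "'v set \<Rightarrow> 'e set \<Rightarrow> ('v, 'e) gen \<Rightarrow> bool" where
  "valid_gen E0 E1 g = (case g of GV v \<Rightarrow> v \<in> E0 | GE e \<Rightarrow> e \<in> E1 | GS e \<Rightarrow> e \<in> E1)"

text \<open>Elements of the free non-unital K-algebra: finitely supported K-valued functions on
  nonempty words over the generators.\<close>
definition free_alg :: "'v set \<Rightarrow> 'e set \<Rightarrow> (('v, 'e) gen list \<Rightarrow> 'k::field) set" where
  "free_alg E0 E1 = {p. finite {w. p w \<noteq> 0} \<and> p [] = 0 \<and>
      (\<forall>w. p w \<noteq> 0 \<longrightarrow> (\<forall>g\<in>set w. valid_gen E0 E1 g))}"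

definition fa_word :: "'g list \<Rightarrow> ('g list \<Rightarrow> 'k::field)" where
  "fa_word w = (\<lambda>u. if u = w then 1 else 0)"

definition fa_mult :: "('g list \<Rightarrow> 'k::field) \<Rightarrow> ('g list \<Rightarrow> 'k) \<Rightarrow> ('g list \<Rightarrow> 'k)" where
  "fa_mult p q = (\<lambda>w. \<Sum>i\<le>length w. p (take i w) * q (drop i w))"

definition fa_minus :: "('g list \<Rightarrow> 'k::field) \<Rightarrow> ('g list \<Rightarrow> 'k) \<Rightarrow> ('g list \<Rightarrow> 'k)" where
  "fa_minus p q = (\<lambda>w. p w - q w)"

inductive_set fa_ideal :: "'v set \<Rightarrow> 'e set \<Rightarrow> ((('v, 'e) gen list \<Rightarrow> 'k::field) set)
    \<Rightarrow> (('v, 'e) gen list \<Rightarrow> 'k) set"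
  for E0 E1 R where
  zero: "(\<lambda>_. 0) \<in> fa_ideal E0 E1 R"
| gen: "\<lbrakk> x \<in> R; \<forall>g\<in>set u. valid_gen E0 E1 g; \<forall>g\<in>set w. valid_gen E0 E1 g \<rbrakk>
        \<Longrightarrow> fa_mult (fa_mult (fa_word u) x) (fa_word w) \<in> fa_ideal E0 E1 R"
| add: "\<lbrakk> p \<in> fa_ideal E0 E1 R; q \<in> fa_ideal E0 E1 R \<rbrakk>
        \<Longrightarrow> (\<lambda>w. p w + q w) \<in> fa_ideal E0 E1 R"
| smult: "p \<in> fa_ideal E0 E1 R \<Longrightarrow> (\<lambda>w. c * p w) \<in> fa_ideal E0 E1 R"

definition CL_rels ::
  "'v set \<Rightarrow> 'e set \<Rightarrow> ('e \<Rightarrow> 'v) \<Rightarrow> ('e \<Rightarrow> 'v) \<Rightarrow> 'e set set \<Rightarrow> 'e set set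
   \<Rightarrow> (('v, 'e) gen list \<Rightarrow> 'k::field) set" where
  "CL_rels E0 E1 r s C S =
     {fa_minus (fa_word [GV v, GV v]) (fa_word [GV v]) | v. v \<in> E0}
   \<union> {fa_word [GV v, GV w] | v w. v \<in> E0 \<and> w \<in> E0 \<and> v \<noteq> w}
   \<union> {fa_minus (fa_word [GV (s e), GE e]) (fa_word [GE e]) | e. e \<in> E1}
   \<union> {fa_minus (fa_word [GE e, GV (r e)]) (fa_word [GE e]) | e. e \<in> E1}
   \<union> {fa_minus (fa_word [GV (r e), GS e]) (fa_word [GS e]) | e. e \<in> E1}
   \<union> {fa_minus (fa_word [GS e, GV (s e)]) (fa_word [GS e]) | e. e \<in> E1}
   \<union> {fa_minus (fa_word [GS e, GE f]) (if e = f then fa_word [GV (r e)] else (\<lambda>_. 0))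
        | e f Y. Y \<in> C \<and> e \<in> Y \<and> f \<in> Y}
   \<union> {fa_minus (fa_word [GV v]) (\<lambda>w. \<Sum>e\<in>X. fa_word [GE e, GS e] w)
        | v X. v \<in> E0 \<and> \<not> is_sink E1 s v \<and> X \<in> S \<and> X \<in> Cv C E1 s v}"

fun gstar :: "('v, 'e) gen \<Rightarrow> ('v, 'e) gen" where
  "gstar (GV v) = GV v"
| "gstar (GE e) = GS e"
| "gstar (GS e) = GE e"

definition word_star :: "('v, 'e) gen list \<Rightarrow> ('v, 'e) gen list" where
  "word_star w = rev (map gstar w)"

text \<open>Elements of the multiplicative semigroup generated by E1 and its adjoints,
  as nonempty words in the letters e, e*.\<close>
definition path_word :: "'e set \<Rightarrow> ('v, 'e) gen list \<Rightarrow> bool" where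
  "path_word E1 w \<longleftrightarrow> w \<noteq> [] \<and> (\<forall>g\<in>set w. \<exists>e\<in>E1. g = GE e \<or> g = GS e)"

definition comm_rels :: "'e set \<Rightarrow> (('v, 'e) gen list \<Rightarrow> 'k::field) set" where
  "comm_rels E1 =
     {fa_minus (fa_word (l @ word_star l @ b @ word_star b))
               (fa_word (b @ word_star b @ l @ word_star l))
        | l b. path_word E1 l \<and> path_word E1 b}"

definition AL_rels ::
  "'v set \<Rightarrow> 'e set \<Rightarrow> ('e \<Rightarrow> 'v) \<Rightarrow> ('e \<Rightarrow> 'v) \<Rightarrow> 'e set set \<Rightarrow> 'e set set
   \<Rightarrow> (('v, 'e) gen list \<Rightarrow> 'k::field) set" where
  "AL_rels E0 E1 r s C S = CL_rels E0 E1 r s C S \<union> comm_rels E1"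

definition Dint :: "('v \<Rightarrow> nat) \<Rightarrow> 'v \<Rightarrow> real set" where
  "Dint idx v = {real (idx v) ..< real (idx v) + 1}"

definition interval_partition :: "real set set \<Rightarrow> real set \<Rightarrow> bool" where
  "interval_partition P A \<longleftrightarrow>
     (\<forall>I\<in>P. \<exists>a b. a < b \<and> I = {a..<b}) \<and>
     (\<forall>I\<in>P. \<forall>J\<in>P. I \<noteq> J \<longrightarrow> I \<inter> J = {}) \<and> \<Union>P = A"

definition enum_index :: "'a set \<Rightarrow> nat set" where
  "enum_index A = (if finite A then {..<card A} else UNIV)"

definition tildeY :: "'e set set \<Rightarrow> 'e set \<Rightarrow> 'e option set" where
  "tildeY S Y = Some ` Y \<union> (if Y \<in> S then {} else {None})"

text \<open>idx enumerates E0; Ys v enumerates C_v; P v n is the partition of D_v at stage n,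
  each interval labelled by L v n with an element of \<open>\<tilde>Y_n\<close>; R and f are the resulting
  sets R_e and bijections f_e.\<close>
definition branching_construction ::
  "'v set \<Rightarrow> 'e set \<Rightarrow> ('e \<Rightarrow> 'v) \<Rightarrow> ('e \<Rightarrow> 'v) \<Rightarrow> 'e set set \<Rightarrow> 'e set set
   \<Rightarrow> ('v \<Rightarrow> nat) \<Rightarrow> ('v \<Rightarrow> nat \<Rightarrow> 'e set) \<Rightarrow> ('v \<Rightarrow> nat \<Rightarrow> real set set)
   \<Rightarrow> ('v \<Rightarrow> nat \<Rightarrow> real set \<Rightarrow> 'e option) \<Rightarrow> ('e \<Rightarrow> real set) \<Rightarrow> ('e \<Rightarrow> real \<Rightarrow> real) \<Rightarrow> bool"
  where
  "branching_construction E0 E1 r s C S idx Ys P L R f \<longleftrightarrow>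
     bij_betw idx E0 (enum_index E0) \<and>
     (\<forall>v\<in>E0. \<not> is_sink E1 s v \<longrightarrow>
        bij_betw (Ys v) (enum_index (Cv C E1 s v)) (Cv C E1 s v) \<and>
        (\<forall>n\<in>enum_index (Cv C E1 s v). interval_partition (P v n) (Dint idx v)) \<and>
        bij_betw (L v 0) (P v 0) (tildeY S (Ys v 0)) \<and>
        (\<forall>n. Suc n \<in> enum_index (Cv C E1 s v) \<longrightarrow>
           (\<forall>J\<in>P v (Suc n). \<exists>I\<in>P v n. J \<subseteq> I) \<and>
           (\<forall>I\<in>P v n.
              interval_partition {J \<in> P v (Suc n). J \<subseteq> I} I \<and>
              bij_betw (L v (Suc n)) {J \<in> P v (Suc n). J \<subseteq> I} (tildeY S (Ys v (Suc n))))) \<and>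
        (\<forall>n\<in>enum_index (Cv C E1 s v). \<forall>e\<in>Ys v n.
           R e = \<Union>{J \<in> P v n. L v n J = Some e} \<and>
           (\<exists>Dfam g. interval_partition Dfam (Dint idx (r e)) \<and>
              bij_betw g Dfam {J \<in> P v n. L v n J = Some e} \<and>
              (\<forall>K\<in>Dfam. bij_betw (f e) K (g K)))))"

text \<open>Functions on the real line; only their values on X = union of the D_v matter,
  and all operators below produce functions vanishing outside X.\<close>
definition gen_op ::
  "('v \<Rightarrow> nat) \<Rightarrow> ('e \<Rightarrow> 'v) \<Rightarrow> ('e \<Rightarrow> real set) \<Rightarrow> ('e \<Rightarrow> real \<Rightarrow> real)
   \<Rightarrow> ('v, 'e) gen \<Rightarrow> (real \<Rightarrow> 'k::field) \<Rightarrow> (real \<Rightarrow> 'k)" where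
  "gen_op idx r R f g \<phi> = (case g of
      GV v \<Rightarrow> (\<lambda>x. if x \<in> Dint idx v then \<phi> x else 0)
    | GE e \<Rightarrow> (\<lambda>x. if x \<in> R e then \<phi> (the_inv_into (Dint idx (r e)) (f e) x) else 0)
    | GS e \<Rightarrow> (\<lambda>x. if x \<in> Dint idx (r e) then \<phi> (f e x) else 0))"

primrec word_op ::
  "('v \<Rightarrow> nat) \<Rightarrow> ('e \<Rightarrow> 'v) \<Rightarrow> ('e \<Rightarrow> real set) \<Rightarrow> ('e \<Rightarrow> real \<Rightarrow> real)
   \<Rightarrow> ('v, 'e) gen list \<Rightarrow> (real \<Rightarrow> 'k::field) \<Rightarrow> (real \<Rightarrow> 'k)" where
  "word_op idx r R f [] \<phi> = \<phi>"
| "word_op idx r R f (g # w) \<phi> = gen_op idx r R f g (word_op idx r R f w \<phi>)"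

definition rep ::
  "('v \<Rightarrow> nat) \<Rightarrow> ('e \<Rightarrow> 'v) \<Rightarrow> ('e \<Rightarrow> real set) \<Rightarrow> ('e \<Rightarrow> real \<Rightarrow> real)
   \<Rightarrow> (('v, 'e) gen list \<Rightarrow> 'k::field) \<Rightarrow> (real \<Rightarrow> 'k) \<Rightarrow> (real \<Rightarrow> 'k)" where
  "rep idx r R f p \<phi> = (\<lambda>x. \<Sum>w\<in>{w. p w \<noteq> 0}. p w * word_op idx r R f w \<phi> x)"

text \<open>pi is faithful on AL_K(E,C,S) = free algebra / ideal(AL_rels): an element of the
  free algebra killed by pi lies in the ideal.\<close>
definition faithful_on_AL ::
  "'v set \<Rightarrow> 'e set \<Rightarrow> ('e \<Rightarrow> 'v) \<Rightarrow> ('e \<Rightarrow> 'v) \<Rightarrow> 'e set set \<Rightarrow> 'e set set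
   \<Rightarrow> ('v \<Rightarrow> nat) \<Rightarrow> ('e \<Rightarrow> real set) \<Rightarrow> ('e \<Rightarrow> real \<Rightarrow> real) \<Rightarrow> 'k::field itself \<Rightarrow> bool" where
  "faithful_on_AL E0 E1 r s C S idx R f _ \<longleftrightarrow>
     (\<forall>p::('v, 'e) gen list \<Rightarrow> 'k. p \<in> free_alg E0 E1 \<longrightarrow>
        (\<forall>\<phi> x. rep idx r R f p \<phi> x = 0) \<longrightarrow> p \<in> fa_ideal E0 E1 (AL_rels E0 E1 r s C S))"

end

theory Submission
  imports Defs "HOL-Library.Function_Algebras"
begin

text \<open>Suppose \<open>p\<close> lies outside the defining ideal and choose a linear functional \<open>T\<close> that
  vanishes on the ideal but not at \<open>p\<close>. As all edges start at \<open>v0\<close>, the range map is injective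
  and there are no loops, every word equals in the algebra either 0, a vertex that is neither
  \<open>v0\<close> nor a range, or \<open>a\<^sup>* q b\<close> with \<open>q\<close> a product of projections \<open>e e\<^sup>*\<close> and
  \<open>a\<close>, \<open>b\<close> edges, possibly absent. Testing \<open>\<pi>(p)\<close> on point masses separates these shapes and
  leaves for each pair \<open>(a, b)\<close> a linear relation between indicator functions of intersections
  of sets \<open>R\<^sub>e\<close> inside the interval of \<open>v0\<close>. Since the projections commute, the corresponding
  relation between values of \<open>T\<close> can be checked on products of factors \<open>e e\<^sup>*\<close> and
  \<open>v0 - e e\<^sup>*\<close>: those that the relations of the algebra do not force to vanish are realized
  by a point, found in a nested sequence of intervals of the construction. Hence \<open>T p = 0\<close>.\<close>

section \<open>Products of words in the free algebra, and separation of a vector from a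
  subspace\<close>

lemma fa_mult_word_word: "fa_mult (fa_word u) (fa_word w) = (fa_word (u @ w) :: 'g list \<Rightarrow> 'k::field)"
proof
  fix z :: "'g list"
  have "fa_mult (fa_word u) (fa_word w) z
      = (\<Sum>i\<le>length z. if i = length u then (if z = u @ w then 1 else 0) else (0::'k))"
    unfolding fa_mult_def fa_word_def
  proof (rule sum.cong[OF refl])
    fix i assume "i \<in> {..length z}"
    then have "take i z = u \<and> drop i z = w \<longleftrightarrow> i = length u \<and> z = u @ w"
      by auto
    then show "(if take i z = u then 1 else 0) * (if drop i z = w then 1 else 0)
        = (if i = length u then if z = u @ w then 1 else 0 else (0::'k))"
      by (cases "i = length u"; cases "z = u @ w"; cases "take i z = u"; cases "drop i z = w") simp_all
  qed
  also have "\<dots> = fa_word (u @ w) z"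
    by (auto simp: fa_word_def)
  finally show "fa_mult (fa_word u) (fa_word w) z = (fa_word (u @ w) z :: 'k)" .
qed

lemma fa_mult_minus_left: "fa_mult (fa_minus p q) x = fa_minus (fa_mult p x) (fa_mult q x)"
  by (simp add: fa_mult_def fa_minus_def algebra_simps sum_subtractf fun_eq_iff)

lemma fa_mult_minus_right: "fa_mult x (fa_minus p q) = fa_minus (fa_mult x p) (fa_mult x q)"
  by (simp add: fa_mult_def fa_minus_def algebra_simps sum_subtractf fun_eq_iff)

lemma fa_mult_zero_left: "fa_mult (\<lambda>_. 0) x = (\<lambda>_. 0)"
  by (simp add: fa_mult_def)

lemma fa_mult_zero_right: "fa_mult x (\<lambda>_. 0) = (\<lambda>_. 0)"
  by (simp add: fa_mult_def)

lemma fa_mult_sum_left: "fa_mult (\<lambda>w. \<Sum>i\<in>A. F i w) x = (\<lambda>w. \<Sum>i\<in>A. fa_mult (F i) x w)"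
  by (simp add: fa_mult_def fun_eq_iff sum_distrib_right sum.swap[of _ A])

lemma fa_mult_sum_right: "fa_mult x (\<lambda>w. \<Sum>i\<in>A. F i w) = (\<lambda>w. \<Sum>i\<in>A. fa_mult x (F i) w)"
  by (simp add: fa_mult_def fun_eq_iff sum_distrib_left sum.swap[of _ A])

lemmas fa_mult_expand = fa_mult_word_word fa_mult_minus_left fa_mult_minus_right
  fa_mult_zero_left fa_mult_zero_right fa_mult_sum_left fa_mult_sum_right

text \<open>A basis of \<open>I\<close> stays independent when \<open>p\<close> is added, because
  its span is \<open>I\<close> and misses \<open>p\<close>; let \<open>T\<close> be 1 at
  \<open>p\<close> and 0 on the basis. Membership in the ideal is thus tested by scalars.\<close>

lemma separating_functional:
  fixes I :: "('a \<Rightarrow> 'k::field) set"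
  assumes zero: "(\<lambda>_. 0) \<in> I"
    and add: "\<And>p q. p \<in> I \<Longrightarrow> q \<in> I \<Longrightarrow> (\<lambda>w. p w + q w) \<in> I"
    and smult: "\<And>c p. p \<in> I \<Longrightarrow> (\<lambda>w. c * p w) \<in> I"
    and p: "p \<notin> I"
  obtains T :: "('a \<Rightarrow> 'k) \<Rightarrow> 'k" where
    "\<And>p q. T (\<lambda>w. p w + q w) = T p + T q" "\<And>c p. T (\<lambda>w. c * p w) = c * T p"
    "\<And>q. q \<in> I \<Longrightarrow> T q = 0" "T p \<noteq> 0"
proof -
  define scl :: "'k \<Rightarrow> ('a \<Rightarrow> 'k) \<Rightarrow> ('a \<Rightarrow> 'k)" where "scl = (\<lambda>c f w. c * f w)"
  interpret VP: vector_space_pair scl "(*) :: 'k \<Rightarrow> 'k \<Rightarrow> 'k"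
    by unfold_locales (auto simp: scl_def fun_eq_iff algebra_simps)
  have sub: "VP.vs1.subspace I"
    unfolding VP.vs1.subspace_def
    using zero add smult by (auto simp: scl_def zero_fun_def plus_fun_def)
  obtain B where B: "B \<subseteq> I" "VP.vs1.independent B" "I \<subseteq> VP.vs1.span B"
    using VP.vs1.basis_exists[of I] by metis
  have "VP.vs1.span B = I"
    using B sub by (simp add: VP.vs1.span_minimal subset_antisym)
  then have ind: "VP.vs1.independent (insert p B)"
    using B(2) p by (simp add: VP.vs1.independent_insert)
  obtain T where T: "Vector_Spaces.linear scl (*) T" "\<forall>x\<in>insert p B. T x = (if x = p then 1 else 0)"
    using VP.linear_independent_extend[OF ind, of "\<lambda>x. if x = p then 1 else 0"] by (elim exE conjE)
  interpret T: Vector_Spaces.linear scl "(*)" T by fact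
  have TB: "T b = 0" if "b \<in> B" for b
    using that T(2) B(1) p by auto
  show ?thesis
  proof
    show "T (\<lambda>w. a w + b w) = T a + T b" for a b
      using T.add[of a b] by (simp add: plus_fun_def)
    show "T (\<lambda>w. c * a w) = c * T a" for a c
      using T.scale[of c a] by (simp add: scl_def)
    show "T q = 0" if "q \<in> I" for q
      using VP.linear_eq_0_on_span[OF T(1), of B q] TB B(3) that by blast
    show "T p \<noteq> 0"
      using T(2) by simp
  qed
qed

section \<open>Inclusion-exclusion\<close>

text \<open>With \<open>\<tau> A\<close> thought of as the value of a linear functional on \<open>\<Prod>a\<in>A. p\<^sub>a\<close>, this is its
  value on \<open>(\<Prod>a\<in>A. p\<^sub>a) (\<Prod>b\<in>B. (1 - p\<^sub>b))\<close>.\<close>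
primrec excl :: "('e set \<Rightarrow> 'k::ab_group_add) \<Rightarrow> 'e set \<Rightarrow> 'e list \<Rightarrow> 'k" where
  "excl \<tau> A [] = \<tau> A"
| "excl \<tau> A (b # B) = excl \<tau> A B - excl \<tau> (insert b A) B"

text \<open>The factor for \<open>b\<close> and its complement multiply to 0: at the entry
  \<open>b\<close> of the list both terms of the difference coincide.\<close>

lemma excl_meet: "b \<in> A \<Longrightarrow> b \<in> set B \<Longrightarrow> excl \<tau> A B = 0"
  by (induction B arbitrary: A) (auto simp: insert_absorb)

text \<open>The value expands into a signed sum of values of \<tau> at supersets of
  \<open>A\<close>.\<close>

lemma excl_vanish: "(\<And>A'. A \<subseteq> A' \<Longrightarrow> \<tau> A' = 0) \<Longrightarrow> excl \<tau> A B = 0"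
proof (induction B arbitrary: A)
  case (Cons b B)
  have "excl \<tau> (insert b A) B = 0"
    by (rule Cons.IH) (use Cons.prems in auto)
  moreover have "excl \<tau> A B = 0"
    by (rule Cons.IH) (use Cons.prems in auto)
  ultimately show ?case
    by simp
qed simp

text \<open>The relation that the projections of \<open>X\<close> add up to 1 survives
  multiplication by the other factors, since inserting \<open>e\<close> commutes with inserting
  entries of \<open>B\<close>.\<close>

lemma excl_sum:
  assumes "\<And>A. \<tau> A = (\<Sum>e\<in>X. \<tau> (insert e A))"
  shows "excl \<tau> A B = (\<Sum>e\<in>X. excl \<tau> (insert e A) B)"
proof (induction B arbitrary: A)
  case (Cons b B)
  show ?case
    using Cons.IH[of A] Cons.IH[of "insert b A"] by (simp add: sum_subtractf insert_commute)
qed (simp only: excl.simps, rule assms)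

text \<open>Splits 1 into the products of the \<open>p\<^sub>a\<close> (\<open>a \<in> A\<close>) and \<open>1 - p\<^sub>b\<close> (\<open>b \<in> B\<close>) over all
  decompositions of the finite set of edges in play. Each such product is either realized by a
  point of \<open>D\<close> or killed by \<open>\<tau>\<close>.\<close>
lemma indicator_relation_imp_functional_relation:
  fixes \<tau> :: "'e set \<Rightarrow> 'k::field" and c :: "'w \<Rightarrow> 'k" and a :: "'w \<Rightarrow> 'e set"
  assumes orth: "\<And>A Y e e'. Y \<in> C \<Longrightarrow> e \<in> Y \<Longrightarrow> e' \<in> Y \<Longrightarrow> e \<noteq> e' \<Longrightarrow> {e, e'} \<subseteq> A \<Longrightarrow> \<tau> A = 0"
    and total: "\<And>A X. X \<in> S \<Longrightarrow> \<tau> A = (\<Sum>e\<in>X. \<tau> (insert e A))"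
    and point: "\<And>A B. finite A \<Longrightarrow> finite B \<Longrightarrow> A \<subseteq> E \<Longrightarrow> B \<subseteq> E \<Longrightarrow> A \<inter> B = {} \<Longrightarrow>
      (\<forall>Y\<in>C. \<forall>e\<in>Y. \<forall>e'\<in>Y. e \<in> A \<and> e' \<in> A \<longrightarrow> e = e') \<Longrightarrow> (\<forall>X\<in>S. \<not> X \<subseteq> B) \<Longrightarrow>
      \<exists>y\<in>D. (\<forall>e\<in>A. y \<in> R e) \<and> (\<forall>e\<in>B. y \<notin> R e)"
    and W: "finite W" "\<And>w. w \<in> W \<Longrightarrow> finite (a w) \<and> a w \<subseteq> E"
    and zero: "\<And>y. y \<in> D \<Longrightarrow> (\<Sum>w\<in>W. c w * (if \<forall>e\<in>a w. y \<in> R e then 1 else 0)) = 0"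
  shows "(\<Sum>w\<in>W. c w * \<tau> (a w)) = 0"
proof -
  \<comment> \<open>\<open>U\<close> lists the undecided edges. The value for \<open>B\<close> is
    the sum of the values with \<open>u\<close> added to \<open>A\<close> and with \<open>u\<close>
    added to \<open>B\<close>, so \<open>U\<close> shrinks by one edge at a time.\<close>
  have main: "(\<Sum>w\<in>W. c w * excl \<tau> (A \<union> a w) B) = 0"
    if "finite A" "A \<subseteq> E" "set B \<subseteq> E" "set U \<subseteq> E" "\<And>w. w \<in> W \<Longrightarrow> a w \<subseteq> A \<union> set B \<union> set U"
    for A B U
    using that
  proof (induction U arbitrary: A B)
    case (Cons u U)
    have "(\<Sum>w\<in>W. c w * excl \<tau> (insert u A \<union> a w) B) = 0"
      by (rule Cons.IH) (use Cons.prems in fastforce)+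
    moreover have "(\<Sum>w\<in>W. c w * excl \<tau> (A \<union> a w) (u # B)) = 0"
      by (rule Cons.IH) (use Cons.prems in fastforce)+
    ultimately show ?case
      by (simp add: algebra_simps sum_subtractf)
  next
    case Nil
    \<comment> \<open>With every edge decided, the projections of \<open>a w\<close> are either
      absorbed by those of \<open>A\<close> or meet a complementary factor.\<close>
    have red: "excl \<tau> (A \<union> a w) B = (if a w \<inter> set B = {} then excl \<tau> A B else 0)" if "w \<in> W" for w
    proof (cases "a w \<inter> set B = {}")
      case True
      then have "a w \<subseteq> A" using Nil(5)[OF that] by auto
      then show ?thesis using True by (simp add: Un_absorb2)
    next
      case False
      then show ?thesis using excl_meet[of _ "A \<union> a w" B \<tau>] by auto
    qed
    show ?case
    proof (cases "excl \<tau> A B = 0")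
      case True
      then have "excl \<tau> (A \<union> a w) B = 0" if "w \<in> W" for w
        using red[OF that] by simp
      then show ?thesis by simp
    next
      case False
      \<comment> \<open>A nonzero value excludes each obstruction to realizing the pattern by a
        point: an edge on both sides, two edges of one block in \<open>A\<close>, a block of
        \<open>S\<close> inside \<open>B\<close>.\<close>
      have "A \<inter> set B = {}"
        using False excl_meet[of _ A B \<tau>] by auto
      moreover have "\<forall>Y\<in>C. \<forall>e\<in>Y. \<forall>e'\<in>Y. e \<in> A \<and> e' \<in> A \<longrightarrow> e = e'"
      proof (intro ballI impI, rule ccontr)
        fix Y e e' assume *: "Y \<in> C" "e \<in> Y" "e' \<in> Y" "e \<in> A \<and> e' \<in> A" "e \<noteq> e'"
        have "excl \<tau> A B = 0"
          by (rule excl_vanish, rule orth[OF *(1-3,5)]) (use * in auto)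
        with False show False by simp
      qed
      moreover have "\<forall>X\<in>S. \<not> X \<subseteq> set B"
      proof (intro ballI notI)
        fix X assume "X \<in> S" "X \<subseteq> set B"
        \<comment> \<open>Every summand demands some \<open>e\<close> of \<open>X\<close> that also
          occurs in \<open>B\<close>, so all of them vanish.\<close>
        then have "excl \<tau> A B = (\<Sum>e\<in>X. excl \<tau> (insert e A) B)"
          by (intro excl_sum total)
        also have "\<dots> = 0"
          using \<open>X \<subseteq> set B\<close> by (intro sum.neutral ballI excl_meet) auto
        finally show False using False by simp
      qed
      ultimately obtain y where y: "y \<in> D" "\<forall>e\<in>A. y \<in> R e" "\<forall>e\<in>set B. y \<notin> R e"
        using point[of A "set B"] Nil by auto
      \<comment> \<open>The sum is the hypothesis \<open>zero\<close> at \<open>y\<close>,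
        multiplied by the common factor \<open>excl \<tau> A B\<close>.\<close>
      have "(\<Sum>w\<in>W. c w * excl \<tau> (A \<union> a w) B)
          = (\<Sum>w\<in>W. c w * (if \<forall>e\<in>a w. y \<in> R e then 1 else 0) * excl \<tau> A B)"
      proof (rule sum.cong[OF refl])
        fix w assume w: "w \<in> W"
        then have "a w \<inter> set B = {} \<longleftrightarrow> (\<forall>e\<in>a w. y \<in> R e)"
          using y Nil(5)[OF w] by auto
        then show "c w * excl \<tau> (A \<union> a w) B
            = c w * (if \<forall>e\<in>a w. y \<in> R e then 1 else 0) * excl \<tau> A B"
          by (simp add: red[OF w])
      qed
      also have "\<dots> = 0"
        using zero[OF y(1)] by (simp flip: sum_distrib_right)
      finally show ?thesis .
    qed
  qed
  have "finite (\<Union>w\<in>W. a w)"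
    using W by auto
  from finite_list[OF this] obtain U where U: "set U = (\<Union>w\<in>W. a w)" ..
  have UE: "set U \<subseteq> E" and aU: "\<And>w. w \<in> W \<Longrightarrow> a w \<subseteq> {} \<union> set [] \<union> set U"
    using W(2) unfolding U by blast+
  have "(\<Sum>w\<in>W. c w * excl \<tau> ({} \<union> a w) []) = 0"
    by (rule main[OF _ _ _ UE aU]) simp_all
  then show ?thesis
    by simp
qed

section \<open>Normal forms of words\<close>

text \<open>\<open>Mon \<alpha> es \<beta>\<close> stands for the product of \<open>e\<^sub>\<alpha>\<^sup>*\<close> (if present), the projections \<open>e e\<^sup>*\<close>
  for \<open>e\<close> in \<open>es\<close>, and \<open>e\<^sub>\<beta>\<close> (if present); \<open>Vert v\<close> is used only for vertices \<open>v \<noteq> v0\<close> that are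
  not the range of an edge.\<close>
datatype ('v, 'e) nform = Zero | Vert 'v | Mon "'e option" "'e list" "'e option"

text \<open>The vertex acting as a left unit on \<open>Mon \<alpha> es \<beta>\<close>; taken at
  \<beta> it is the right unit.\<close>

definition corner :: "('e \<Rightarrow> 'v) \<Rightarrow> 'v \<Rightarrow> 'e option \<Rightarrow> 'v" where
  "corner r v0 \<alpha> = (case \<alpha> of None \<Rightarrow> v0 | Some e \<Rightarrow> r e)"

lemma corner_simps [simp]: "corner r v0 None = v0" "corner r v0 (Some e) = r e"
  by (simp_all add: corner_def)

definition proj_word :: "'e list \<Rightarrow> ('v, 'e) gen list" where
  "proj_word es = concat (map (\<lambda>e. [GE e, GS e]) es)"

lemma proj_word_simps [simp]:
  "proj_word [] = []" "proj_word (e # es) = GE e # GS e # proj_word es"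
  "proj_word (es @ es') = proj_word es @ proj_word es'"
  by (simp_all add: proj_word_def)

definition star_part :: "'e option \<Rightarrow> ('v, 'e) gen list" where
  "star_part \<alpha> = (case \<alpha> of None \<Rightarrow> [] | Some e \<Rightarrow> [GS e])"

definition edge_part :: "'e option \<Rightarrow> ('v, 'e) gen list" where
  "edge_part \<beta> = (case \<beta> of None \<Rightarrow> [] | Some e \<Rightarrow> [GE e])"

lemma part_simps [simp]:
  "star_part None = []" "star_part (Some e) = [GS e]"
  "edge_part None = []" "edge_part (Some e) = [GE e]"
  by (simp_all add: star_part_def edge_part_def)

locale star_graph =
  fixes E0 :: "'v set" and E1 :: "'e set" and r s :: "'e \<Rightarrow> 'v"
    and C S :: "'e set set" and v0 :: 'v
  assumes sep: "separated_graph E0 E1 r s C"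
    and v0: "v0 \<in> E0"
    and source: "e \<in> E1 \<Longrightarrow> s e = v0"
    and inj_r: "inj_on r E1"
    and no_loop: "e \<in> E1 \<Longrightarrow> r e \<noteq> v0"
    and S_fin: "S \<subseteq> C_fin C"
begin

abbreviation valid :: "('v, 'e) gen list \<Rightarrow> bool" where
  "valid w \<equiv> \<forall>g\<in>set w. valid_gen E0 E1 g"

lemma valid_gen_simps [simp]:
  "valid_gen E0 E1 (GV v) \<longleftrightarrow> v \<in> E0" "valid_gen E0 E1 (GE e) \<longleftrightarrow> e \<in> E1"
  "valid_gen E0 E1 (GS e) \<longleftrightarrow> e \<in> E1"
  by (simp_all add: valid_gen_def)

lemma sepD:
  "graph E0 E1 r s" "C = (\<Union>v\<in>E0. Cv C E1 s v)"
  "v \<in> E0 \<Longrightarrow> \<not> is_sink E1 s v \<Longrightarrow> X \<in> Cv C E1 s v \<Longrightarrow> X \<noteq> {}"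
  "v \<in> E0 \<Longrightarrow> \<not> is_sink E1 s v \<Longrightarrow> \<Union>(Cv C E1 s v) = {e \<in> E1. s e = v}"
  "v \<in> E0 \<Longrightarrow> is_sink E1 s v \<Longrightarrow> Cv C E1 s v = {}"
proof -
  note * = sep[unfolded separated_graph_def]
  show "graph E0 E1 r s"
    by (rule *[THEN conjunct1])
  show "C = (\<Union>v\<in>E0. Cv C E1 s v)"
    by (rule *[THEN conjunct2, THEN conjunct1])
  note ** = *[THEN conjunct2, THEN conjunct2]
  show "v \<in> E0 \<Longrightarrow> \<not> is_sink E1 s v \<Longrightarrow> X \<in> Cv C E1 s v \<Longrightarrow> X \<noteq> {}"
    "v \<in> E0 \<Longrightarrow> \<not> is_sink E1 s v \<Longrightarrow> \<Union>(Cv C E1 s v) = {e \<in> E1. s e = v}"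
    "v \<in> E0 \<Longrightarrow> is_sink E1 s v \<Longrightarrow> Cv C E1 s v = {}"
    using ** by simp_all
qed

lemma range_in: "e \<in> E1 \<Longrightarrow> r e \<in> E0"
  using sepD(1) by (simp add: graph_def)

lemma r_eq_iff: "e \<in> E1 \<Longrightarrow> e' \<in> E1 \<Longrightarrow> r e = r e' \<longleftrightarrow> e = e'"
  using inj_r by (auto simp: inj_on_def)

text \<open>Blocks exist only at non-sinks and are nonempty, so \<open>Y\<close> contains an edge
  leaving its vertex; every edge leaves \<open>v0\<close>.\<close>

lemma C_member:
  assumes "Y \<in> C"
  shows "Y \<noteq> {}" "Y \<subseteq> E1" "Y \<in> Cv C E1 s v0" "\<not> is_sink E1 s v0"
proof -
  obtain v where v: "v \<in> E0" "Y \<in> Cv C E1 s v"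
    using sepD(2) assms by blast
  then have nonsink: "\<not> is_sink E1 s v"
    using sepD(5) by blast
  then have ne: "Y \<noteq> {}"
    using sepD(3) v by blast
  have sub: "Y \<subseteq> {e \<in> E1. s e = v}"
    using v by (simp add: Cv_def)
  then have "v = v0"
    using ne source by blast
  with v nonsink ne sub show "Y \<noteq> {}" "Y \<subseteq> E1" "Y \<in> Cv C E1 s v0" "\<not> is_sink E1 s v0"
    by auto
qed

lemma S_member: "X \<in> S \<Longrightarrow> X \<in> C" "X \<in> S \<Longrightarrow> finite X"
  using S_fin by (auto simp: C_fin_def)

lemma edge_in_C:
  assumes "e \<in> E1"
  obtains Y where "Y \<in> C" "e \<in> Y"
proof -
  have "\<not> is_sink E1 s v0"
    using source assms by (auto simp: is_sink_def)
  then have "\<Union>(Cv C E1 s v0) = {e \<in> E1. s e = v0}"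
    using sepD(4) v0 by blast
  then have "e \<in> \<Union>(Cv C E1 s v0)"
    using assms source by blast
  then show ?thesis
    using that unfolding Cv_def by blast
qed

text \<open>Letters are padded with the projections of their edges: e = e e^* e, and likewise for
  e^*, while r(e) = e^* e becomes e^* e e^* e. This starts the invariant
  \<open>nf_ok\<close>.\<close>

definition nf_letter :: "('v, 'e) gen \<Rightarrow> ('v, 'e) nform" where
  "nf_letter g = (case g of
      GV v \<Rightarrow> if v = v0 then Mon None [] None
             else if v \<in> r ` E1 then (let e = the_inv_into E1 r v in Mon (Some e) [e] (Some e))
             else Vert v
    | GE e \<Rightarrow> Mon None [e] (Some e)
    | GS e \<Rightarrow> Mon (Some e) [e] None)"

text \<open>Left multiplication. \<open>GE e\<close> kills a form without star part because r(e) is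
  not \<open>v0\<close>, and one with the star of another edge because ranges differ;
  \<open>GS e\<close> kills every star part because no range is \<open>v0\<close>. Otherwise a
  projection e e^* appears as a new factor.\<close>

fun nf_act :: "('v, 'e) gen \<Rightarrow> ('v, 'e) nform \<Rightarrow> ('v, 'e) nform" where
  "nf_act g Zero = Zero"
| "nf_act (GV v) (Vert w) = (if v = w then Vert w else Zero)"
| "nf_act g (Vert w) = Zero"
| "nf_act (GV v) (Mon \<alpha> es \<beta>) = (if v = corner r v0 \<alpha> then Mon \<alpha> es \<beta> else Zero)"
| "nf_act (GE e) (Mon \<alpha> es \<beta>) = (if \<alpha> = Some e then Mon None (e # es) \<beta> else Zero)"
| "nf_act (GS e) (Mon \<alpha> es \<beta>) = (if \<alpha> = None then Mon (Some e) (e # es) \<beta> else Zero)"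

text \<open>The value at the empty word is a dummy, since the free algebra is spanned by nonempty
  words.\<close>

fun nf :: "('v, 'e) gen list \<Rightarrow> ('v, 'e) nform" where
  "nf [] = Zero"
| "nf [g] = nf_letter g"
| "nf (g # h # w) = nf_act g (nf (h # w))"

text \<open>The outer edges of a \<open>Mon\<close> must occur among its projections. A point
  passing all tests then lies in the set \<open>R e\<close> on which the map of an outer edge is
  inverted.\<close>

definition nf_ok :: "('v, 'e) nform \<Rightarrow> bool" where
  "nf_ok n = (case n of
      Zero \<Rightarrow> True
    | Vert v \<Rightarrow> v \<in> E0 \<and> v \<noteq> v0 \<and> v \<notin> r ` E1
    | Mon \<alpha> es \<beta> \<Rightarrow> set es \<subseteq> E1 \<and> set_option \<alpha> \<subseteq> set es \<and> set_option \<beta> \<subseteq> set es)"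

lemma nf_letter_GV_range: "e \<in> E1 \<Longrightarrow> nf_letter (GV (r e)) = Mon (Some e) [e] (Some e)"
  using inj_r no_loop by (simp add: nf_letter_def the_inv_into_f_f Let_def)

lemma letter_cases:
  assumes "valid_gen E0 E1 g"
  obtains "g = GV v0" | e where "e \<in> E1" "g = GV (r e)"
    | v where "v \<in> E0" "v \<noteq> v0" "v \<notin> r ` E1" "g = GV v"
    | e where "e \<in> E1" "g = GE e" | e where "e \<in> E1" "g = GS e"
  using assms by (cases g) auto

lemma nf_ok_letter:
  assumes "valid_gen E0 E1 g"
  shows "nf_ok (nf_letter g)"
  using assms
proof (cases rule: letter_cases)
  case (2 e)
  then show ?thesis by (simp add: nf_letter_GV_range nf_ok_def)
qed (simp_all add: nf_letter_def nf_ok_def)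

lemma nf_ok_act:
  assumes "valid_gen E0 E1 g" "nf_ok n"
  shows "nf_ok (nf_act g n)"
proof (cases n)
  case (Vert v)
  then show ?thesis using assms by (cases g) (simp_all add: nf_ok_def)
next
  case (Mon \<alpha> es \<beta>)
  then show ?thesis using assms by (cases g; cases \<alpha>) (auto simp: nf_ok_def)
qed (simp add: nf_ok_def)

lemma nf_ok_nf: "valid w \<Longrightarrow> nf_ok (nf w)"
proof (induction w rule: nf.induct)
  case 1
  then show ?case by (simp add: nf_ok_def)
next
  case (2 g)
  then show ?case by (simp add: nf_ok_letter)
next
  case (3 g h w)
  then show ?case by (simp add: nf_ok_act)
qed

end

section \<open>Linear functionals on the abelianized Cohn-Leavitt algebra\<close>

text \<open>A functional given by its values on words. The assumptions are the defining relations
  placed between arbitrary words \<open>u\<close> and \<open>w\<close>, with \<open>v0\<close>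
  written for all sources and commutation stated for the projections of single edges.\<close>

locale star_functional = star_graph +
  fixes t :: "('a, 'b) gen list \<Rightarrow> 'k::field"
  assumes VV: "v \<in> E0 \<Longrightarrow> valid u \<Longrightarrow> valid w \<Longrightarrow> t (u @ GV v # GV v # w) = t (u @ GV v # w)"
    and VW: "v \<in> E0 \<Longrightarrow> v' \<in> E0 \<Longrightarrow> v \<noteq> v' \<Longrightarrow> valid u \<Longrightarrow> valid w \<Longrightarrow>
      t (u @ GV v # GV v' # w) = 0"
    and sE: "e \<in> E1 \<Longrightarrow> valid u \<Longrightarrow> valid w \<Longrightarrow> t (u @ GV v0 # GE e # w) = t (u @ GE e # w)"
    and Er: "e \<in> E1 \<Longrightarrow> valid u \<Longrightarrow> valid w \<Longrightarrow> t (u @ GE e # GV (r e) # w) = t (u @ GE e # w)"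
    and rS: "e \<in> E1 \<Longrightarrow> valid u \<Longrightarrow> valid w \<Longrightarrow> t (u @ GV (r e) # GS e # w) = t (u @ GS e # w)"
    and Ss: "e \<in> E1 \<Longrightarrow> valid u \<Longrightarrow> valid w \<Longrightarrow> t (u @ GS e # GV v0 # w) = t (u @ GS e # w)"
    and SE: "e \<in> E1 \<Longrightarrow> valid u \<Longrightarrow> valid w \<Longrightarrow> t (u @ GS e # GE e # w) = t (u @ GV (r e) # w)"
    and SE': "Y \<in> C \<Longrightarrow> e \<in> Y \<Longrightarrow> e' \<in> Y \<Longrightarrow> e \<noteq> e' \<Longrightarrow> valid u \<Longrightarrow> valid w \<Longrightarrow>
      t (u @ GS e # GE e' # w) = 0"
    and total: "X \<in> S \<Longrightarrow> valid u \<Longrightarrow> valid w \<Longrightarrow>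
      t (u @ GV v0 # w) = (\<Sum>e\<in>X. t (u @ GE e # GS e # w))"
    and comm: "e \<in> E1 \<Longrightarrow> e' \<in> E1 \<Longrightarrow> valid u \<Longrightarrow> valid w \<Longrightarrow>
      t (u @ GE e # GS e # GE e' # GS e' # w) = t (u @ GE e' # GS e' # GE e # GS e # w)"
begin

lemma EV0: "e \<in> E1 \<Longrightarrow> v \<in> E0 \<Longrightarrow> v \<noteq> r e \<Longrightarrow> valid u \<Longrightarrow> valid w \<Longrightarrow> t (u @ GE e # GV v # w) = 0"
  using Er[of e u "GV v # w"] VW[of "r e" v "u @ [GE e]" w] by (simp add: range_in)

lemma SV0: "e \<in> E1 \<Longrightarrow> v \<in> E0 \<Longrightarrow> v \<noteq> v0 \<Longrightarrow> valid u \<Longrightarrow> valid w \<Longrightarrow> t (u @ GS e # GV v # w) = 0"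
  using Ss[of e u "GV v # w"] VW[of v0 v "u @ [GS e]" w] by (simp add: v0)

lemma VS0: "e \<in> E1 \<Longrightarrow> v \<in> E0 \<Longrightarrow> v \<noteq> r e \<Longrightarrow> valid u \<Longrightarrow> valid w \<Longrightarrow> t (u @ GV v # GS e # w) = 0"
  using rS[of e "u @ [GV v]" w] VW[of v "r e" u "GS e # w"] by (simp add: range_in)

text \<open>Injectivity of the range map makes the two ranges inserted between the letters
  orthogonal.\<close>

lemma ES0: "e \<in> E1 \<Longrightarrow> e' \<in> E1 \<Longrightarrow> e' \<noteq> e \<Longrightarrow> valid u \<Longrightarrow> valid w \<Longrightarrow> t (u @ GE e # GS e' # w) = 0"
  using rS[of e' "u @ [GE e]" w] EV0[of e "r e'" u "GS e' # w"] by (simp add: range_in r_eq_iff)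

text \<open>Between the letters stand \<open>v0\<close> and a range, which are orthogonal in the
  absence of loops.\<close>

lemma SS0: "e \<in> E1 \<Longrightarrow> e' \<in> E1 \<Longrightarrow> valid u \<Longrightarrow> valid w \<Longrightarrow> t (u @ GS e # GS e' # w) = 0"
  using rS[of e' "u @ [GS e]" w] SV0[of e "r e'" u "GS e' # w"] by (simp add: range_in no_loop)

lemma ESE: "e \<in> E1 \<Longrightarrow> valid u \<Longrightarrow> valid w \<Longrightarrow> t (u @ GE e # GS e # GE e # w) = t (u @ GE e # w)"
  using SE[of e "u @ [GE e]" w] Er[of e u w] by simp

lemma SES: "e \<in> E1 \<Longrightarrow> valid u \<Longrightarrow> valid w \<Longrightarrow> t (u @ GS e # GE e # GS e # w) = t (u @ GS e # w)"
  using SE[of e u "GS e # w"] rS[of e u w] by simp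

lemma ES: "e \<in> E1 \<Longrightarrow> valid u \<Longrightarrow> valid w \<Longrightarrow>
    t (u @ GS e # GV v0 # GE e # GS e # w) = t (u @ GS e # w)"
  using SES[of e u w] Ss[of e u "GE e # GS e # w"] by simp

text \<open>The letter \<open>GV v0\<close> gives the empty product of projections a nonempty word.
  The prefix \<open>u\<close> is carried along for the induction on words.\<close>

definition nf_val :: "('a, 'b) gen list \<Rightarrow> ('a, 'b) nform \<Rightarrow> 'k" where
  "nf_val u n = (case n of
      Zero \<Rightarrow> 0
    | Vert v \<Rightarrow> t (u @ [GV v])
    | Mon \<alpha> es \<beta> \<Rightarrow> t (u @ star_part \<alpha> @ GV v0 # proj_word es @ edge_part \<beta>))"

lemma valid_proj_word [simp]: "valid (proj_word es) \<longleftrightarrow> set es \<subseteq> E1"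
  by (induction es) auto

lemma valid_parts [simp]:
  "valid (star_part \<alpha>) \<longleftrightarrow> set_option \<alpha> \<subseteq> E1" "valid (edge_part \<alpha>) \<longleftrightarrow> set_option \<alpha> \<subseteq> E1"
  by (cases \<alpha>; simp)+

lemma nf_val_letter:
  assumes "valid_gen E0 E1 g" and u: "valid u"
  shows "t (u @ [g]) = nf_val u (nf_letter g)"
  using assms(1)
proof (cases rule: letter_cases)
  case (2 e)
  then show ?thesis
    using SE[of e u "[]"] ESE[of e "u @ [GS e]" "[]"] Ss[of e u "GE e # GS e # [GE e]"] u
    by (simp add: nf_letter_GV_range nf_val_def)
next
  case (4 e)
  then show ?thesis
    using ESE[of e u "[]"] sE[of e u "[GS e, GE e]"] u
    by (simp add: nf_letter_def nf_val_def)
next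
  case (5 e)
  then show ?thesis
    using ES[of e u "[]"] u by (simp add: nf_letter_def nf_val_def)
qed (auto simp: nf_letter_def nf_val_def)

text \<open>Multiplying by \<open>g\<close> lengthens the prefix, so each clause of
  \<open>nf_act\<close> turns into one of the relations for \<open>t\<close>.\<close>

lemma nf_val_act:
  assumes g: "valid_gen E0 E1 g" and u: "valid u" and n: "nf_ok n"
  shows "nf_val (u @ [g]) n = nf_val u (nf_act g n)"
proof (cases n)
  case Zero
  then show ?thesis by (simp add: nf_val_def)
next
  case (Vert w)
  then show ?thesis
  proof (cases g)
    case (GV v)
    then show ?thesis
      using g n u Vert VV[of w u "[]"] VW[of v w u "[]"]
      by (cases "v = w") (simp_all add: nf_val_def nf_ok_def)
  next
    case (GE e)
    then have "w \<noteq> r e"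
      using g n Vert by (auto simp: nf_ok_def)
    then show ?thesis
      using g n u Vert GE EV0[of e w u "[]"] by (simp add: nf_val_def nf_ok_def)
  next
    case (GS e)
    then show ?thesis
      using g n u Vert SV0[of e w u "[]"] by (simp add: nf_val_def nf_ok_def)
  qed
next
  case (Mon \<alpha> es \<beta>)
  define z :: "('a, 'b) gen list" where "z = proj_word es @ edge_part \<beta>"
  have z: "valid z" and \<alpha>: "set_option \<alpha> \<subseteq> E1"
    using n Mon by (auto simp: z_def nf_ok_def ball_Un)
  have val: "nf_val u' (Mon \<alpha>' (es' @ es) \<beta>) = t (u' @ star_part \<alpha>' @ GV v0 # proj_word es' @ z)"
    for u' \<alpha>' es'
    by (simp add: nf_val_def z_def)
  note val0 = val[of _ _ "[]", simplified] and val1 = val[of _ _ "[e]" for e, simplified]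
  have zero: "nf_val u' Zero = 0" for u'
    by (simp add: nf_val_def)
  show ?thesis
  proof (cases g)
    case (GV v)
    show ?thesis
    proof (cases \<alpha>)
      case None
      then show ?thesis
        using g u z v0 GV VV[of v0 u z] VW[of v v0 u z] by (cases "v = v0") (simp_all add: Mon val0 zero)
    next
      case (Some e)
      then show ?thesis
        using g u z v0 \<alpha> GV rS[of e u "GV v0 # z"] VS0[of e v u "GV v0 # z"]
        by (cases "v = r e") (simp_all add: Mon val0 zero)
    qed
  next
    case (GE e)
    show ?thesis
    proof (cases \<alpha>)
      case None
      then show ?thesis
        using g u z v0 GE EV0[of e v0 u z] no_loop[of e] by (simp add: Mon val0 zero)
    next
      case (Some e')
      then show ?thesis
        using g u z v0 \<alpha> GE ES0[of e e' u "GV v0 # z"] Ss[of e "u @ [GE e]" z]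
          sE[of e u "GS e # z"]
        by (cases "e' = e") (simp_all add: Mon val0 val1 zero)
    qed
  next
    case (GS e)
    show ?thesis
    proof (cases \<alpha>)
      case None
      then show ?thesis
        using g u z v0 GS ES[of e u z] Ss[of e u z] by (simp add: Mon val0 val1 zero)
    next
      case (Some e')
      then show ?thesis
        using g u z v0 \<alpha> GS SS0[of e e' u "GV v0 # z"] by (simp add: Mon val0 zero)
    qed
  qed
qed

lemma nf_val_nf: "valid u \<Longrightarrow> valid w \<Longrightarrow> w \<noteq> [] \<Longrightarrow> t (u @ w) = nf_val u (nf w)"
proof (induction w arbitrary: u rule: nf.induct)
  case (2 g)
  then show ?case by (simp add: nf_val_letter)
next
  case (3 g h w)
  have "t (u @ g # h # w) = nf_val (u @ [g]) (nf (h # w))"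
    using 3(1)[of "u @ [g]"] 3(2-) by auto
  also have "\<dots> = nf_val u (nf (g # h # w))"
    using 3(2-) nf_ok_nf[of "h # w"] by (simp add: nf_val_act)
  finally show ?case .
qed simp

definition proj_val :: "('a, 'b) gen list \<Rightarrow> ('a, 'b) gen list \<Rightarrow> 'b list \<Rightarrow> 'k" where
  "proj_val u w es = t (u @ GV v0 # proj_word es @ w)"

context
  fixes u w :: "('a, 'b) gen list"
  assumes u: "valid u" and w: "valid w"
begin

lemma proj_val_shift:
  "set l \<subseteq> E1 \<Longrightarrow> e \<in> E1 \<Longrightarrow> set xs \<subseteq> E1 \<Longrightarrow> set m \<subseteq> E1 \<Longrightarrow>
    proj_val u w (l @ e # xs @ m) = proj_val u w (l @ xs @ e # m)"
proof (induction xs arbitrary: l)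
  case (Cons x xs)
  have "proj_val u w (l @ e # x # xs @ m) = proj_val u w (l @ x # e # xs @ m)"
    using comm[of e x "u @ GV v0 # proj_word l" "proj_word (xs @ m) @ w"] Cons.prems u w v0
    by (simp add: proj_val_def ball_Un)
  also have "\<dots> = proj_val u w (l @ x # xs @ e # m)"
    using Cons.IH[of "l @ [x]"] Cons.prems by simp
  finally show ?case by simp
qed simp

text \<open>Commutation moves \<open>e\<close> next to its other occurrence, where e e^* is
  idempotent.\<close>

lemma proj_val_absorb:
  assumes "set ys \<subseteq> E1" "e \<in> set ys"
  shows "proj_val u w (e # ys) = proj_val u w ys"
proof -
  obtain a b where ys: "ys = a @ e # b"
    using assms(2) by (meson split_list)
  have "proj_val u w (e # ys) = proj_val u w (e # e # a @ b)"
    using proj_val_shift[of "[e]" e a b] assms ys by simp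
  also have "\<dots> = proj_val u w (e # a @ b)"
    using ESE[of e "u @ [GV v0]" "GS e # proj_word (a @ b) @ w"] assms ys u w v0
    by (simp add: proj_val_def ball_Un)
  also have "\<dots> = proj_val u w ys"
    using proj_val_shift[of "[]" e a b] assms ys by simp
  finally show ?thesis .
qed

lemma proj_val_absorb_list:
  "set ys \<subseteq> E1 \<Longrightarrow> set xs \<subseteq> set ys \<Longrightarrow> proj_val u w (xs @ ys) = proj_val u w ys"
  by (induction xs) (auto simp: proj_val_absorb)

lemma proj_val_swap:
  "set l \<subseteq> E1 \<Longrightarrow> set xs \<subseteq> E1 \<Longrightarrow> set ys \<subseteq> E1 \<Longrightarrow>
    proj_val u w (l @ xs @ ys) = proj_val u w (l @ ys @ xs)"
proof (induction xs arbitrary: l)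
  case (Cons x xs)
  then show ?case
    using Cons.IH[of "l @ [x]"] proj_val_shift[of l x ys xs] by simp
qed simp

text \<open>Each list absorbs the other when that is put in front of it, and the two concatenations
  agree by commutation.\<close>

lemma proj_val_cong:
  assumes "set xs \<subseteq> E1" "set xs = set ys"
  shows "proj_val u w xs = proj_val u w ys"
  using proj_val_absorb_list[of ys xs] proj_val_absorb_list[of xs ys]
    proj_val_swap[of "[]" xs ys] assms by simp

text \<open>The choice of a list is immaterial by \<open>proj_val_cong\<close>. The default 0
  extends the relations \<open>set_val_orth\<close> and \<open>set_val_total\<close> to arbitrary
  sets \<open>A\<close>.\<close>

definition set_val :: "'b set \<Rightarrow> 'k" where
  "set_val A = (if finite A \<and> A \<subseteq> E1 then proj_val u w (SOME xs. set xs = A) else 0)"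

lemma set_val_set: "set xs \<subseteq> E1 \<Longrightarrow> set_val (set xs) = proj_val u w xs"
proof -
  assume xs: "set xs \<subseteq> E1"
  have "set (SOME ys. set ys = set xs) = set xs"
    by (rule someI) (rule refl)
  then show ?thesis
    using proj_val_cong[of "SOME ys. set ys = set xs" xs] xs by (simp add: set_val_def)
qed

lemma set_val_orth:
  assumes "Y \<in> C" "e \<in> Y" "e' \<in> Y" "e \<noteq> e'" "{e, e'} \<subseteq> A"
  shows "set_val A = 0"
proof (cases "finite A \<and> A \<subseteq> E1")
  case True
  then obtain xs where xs: "set xs = A" using finite_list by blast
  have "set_val A = proj_val u w (e # e' # xs)"
    using set_val_set[of "e # e' # xs"] xs True assms by (auto simp: insert_absorb)
  also have "\<dots> = 0"
    using SE'[OF assms(1-4), of "u @ [GV v0, GE e]" "GS e' # proj_word xs @ w"] xs True assms u w v0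
    by (auto simp: proj_val_def ball_Un)
  finally show ?thesis .
qed (auto simp: set_val_def)

lemma set_val_total:
  assumes X: "X \<in> S"
  shows "set_val A = (\<Sum>e\<in>X. set_val (insert e A))"
proof (cases "finite A \<and> A \<subseteq> E1")
  case True
  then obtain xs where xs: "set xs = A" using finite_list by blast
  have XE: "X \<subseteq> E1" using C_member S_member X by blast
  have "set_val A = proj_val u w xs"
    using set_val_set xs True by blast
  \<comment> \<open>The relation for \<open>X\<close> consumes the letter \<open>v0\<close>;
    \<open>sE\<close> puts it back in front of each \<open>e\<close>.\<close>
  also have "\<dots> = (\<Sum>e\<in>X. t (u @ GE e # GS e # proj_word xs @ w))"
    using total[OF X u, of "proj_word xs @ w"] w xs True by (simp add: proj_val_def ball_Un)
  also have "\<dots> = (\<Sum>e\<in>X. set_val (insert e A))"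
  proof (rule sum.cong[OF refl])
    fix e assume "e \<in> X"
    then show "t (u @ GE e # GS e # proj_word xs @ w) = set_val (insert e A)"
      using sE[of e u "GS e # proj_word xs @ w"] set_val_set[of "e # xs"] XE xs True u w
      by (auto simp: proj_val_def ball_Un)
  qed
  finally show ?thesis .
next
  case False
  have XE: "X \<subseteq> E1" using C_member S_member X by blast
  show ?thesis
    using False XE by (subst sum.neutral) (auto simp: set_val_def)
qed

end

end

section \<open>Normal forms as operators\<close>

text \<open>The interface between the intervals and the algebra. By \<open>point\<close>, every
  finite pattern of membership in the sets \<open>R e\<close> that the relations allow is
  realized.\<close>

locale star_rep = star_graph +
  fixes idx :: "'a \<Rightarrow> nat" and R :: "'b \<Rightarrow> real set" and f :: "'b \<Rightarrow> real \<Rightarrow> real"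
  assumes inj_idx: "inj_on idx E0"
    and R_sub: "e \<in> E1 \<Longrightarrow> R e \<subseteq> Dint idx v0"
    and bij_f: "e \<in> E1 \<Longrightarrow> bij_betw (f e) (Dint idx (r e)) (R e)"
    and point: "finite A \<Longrightarrow> finite B \<Longrightarrow> A \<subseteq> E1 \<Longrightarrow> B \<subseteq> E1 \<Longrightarrow> A \<inter> B = {} \<Longrightarrow>
      (\<forall>Y\<in>C. \<forall>e\<in>Y. \<forall>e'\<in>Y. e \<in> A \<and> e' \<in> A \<longrightarrow> e = e') \<Longrightarrow> (\<forall>X\<in>S. \<not> X \<subseteq> B) \<Longrightarrow>
      \<exists>y\<in>Dint idx v0. (\<forall>e\<in>A. y \<in> R e) \<and> (\<forall>e\<in>B. y \<notin> R e)"
begin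

abbreviation D :: "'a \<Rightarrow> real set" where "D \<equiv> Dint idx"

definition fwd :: "'b option \<Rightarrow> real \<Rightarrow> real" where
  "fwd \<alpha> = (case \<alpha> of None \<Rightarrow> id | Some e \<Rightarrow> f e)"

definition bwd :: "'b option \<Rightarrow> real \<Rightarrow> real" where
  "bwd \<alpha> = (case \<alpha> of None \<Rightarrow> id | Some e \<Rightarrow> the_inv_into (D (r e)) (f e))"

lemma fwd_bwd_simps [simp]:
  "fwd None = id" "fwd (Some e) = f e"
  "bwd None = id" "bwd (Some e) = the_inv_into (D (r e)) (f e)"
  by (simp_all add: fwd_def bwd_def)

lemma Dint_disjoint: "v \<in> E0 \<Longrightarrow> w \<in> E0 \<Longrightarrow> x \<in> D v \<Longrightarrow> x \<in> D w \<Longrightarrow> v = w"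
proof -
  assume *: "v \<in> E0" "w \<in> E0" "x \<in> D v" "x \<in> D w"
  then have "idx v = idx w"
    by (simp add: Dint_def)
  then show ?thesis
    using inj_idx * by (simp add: inj_on_def)
qed

lemma f_in: "e \<in> E1 \<Longrightarrow> x \<in> D (r e) \<Longrightarrow> f e x \<in> R e"
  using bij_f by (meson bij_betwE)

lemma inv_f: "e \<in> E1 \<Longrightarrow> x \<in> D (r e) \<Longrightarrow> the_inv_into (D (r e)) (f e) (f e x) = x"
  using bij_f by (simp add: bij_betw_def the_inv_into_f_f)

lemma f_inv: "e \<in> E1 \<Longrightarrow> y \<in> R e \<Longrightarrow> f e (the_inv_into (D (r e)) (f e) y) = y"
  using bij_f by (simp add: bij_betw_def f_the_inv_into_f)

lemma inv_in: "e \<in> E1 \<Longrightarrow> y \<in> R e \<Longrightarrow> the_inv_into (D (r e)) (f e) y \<in> D (r e)"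
  using bij_f[of e] the_inv_into_into[of "f e" "D (r e)" y "D (r e)"] by (auto simp: bij_betw_def)

lemma corner_in: "set_option \<alpha> \<subseteq> E1 \<Longrightarrow> corner r v0 \<alpha> \<in> E0"
  by (cases \<alpha>) (auto simp: v0 range_in)

lemma corner_eq_iff:
  "set_option \<alpha> \<subseteq> E1 \<Longrightarrow> set_option \<beta> \<subseteq> E1 \<Longrightarrow> corner r v0 \<alpha> = corner r v0 \<beta> \<longleftrightarrow> \<alpha> = \<beta>"
  using no_loop by (cases \<alpha>; cases \<beta>) (auto simp: r_eq_iff)

lemma bwd_in:
  "set_option \<alpha> \<subseteq> E1 \<Longrightarrow> y \<in> D v0 \<Longrightarrow> \<forall>e\<in>set_option \<alpha>. y \<in> R e \<Longrightarrow> bwd \<alpha> y \<in> D (corner r v0 \<alpha>)"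
  by (cases \<alpha>) (auto simp: inv_in)

lemma fwd_bwd:
  "set_option \<alpha> \<subseteq> E1 \<Longrightarrow> \<forall>e\<in>set_option \<alpha>. y \<in> R e \<Longrightarrow> fwd \<alpha> (bwd \<alpha> y) = y"
  by (cases \<alpha>) (auto simp: f_inv)

text \<open>All tests take place in the interval of \<open>v0\<close>, where products of projections
  act as indicator functions; the outer edges transport points there and back.\<close>

definition nf_op :: "('a, 'b) nform \<Rightarrow> (real \<Rightarrow> 'k::field) \<Rightarrow> real \<Rightarrow> 'k" where
  "nf_op n \<phi> x = (case n of
      Zero \<Rightarrow> 0
    | Vert v \<Rightarrow> if x \<in> D v then \<phi> x else 0
    | Mon \<alpha> es \<beta> \<Rightarrow>
        if x \<in> D (corner r v0 \<alpha>) \<and> (\<forall>e\<in>set es. fwd \<alpha> x \<in> R e) then \<phi> (bwd \<beta> (fwd \<alpha> x)) else 0)"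

text \<open>The padding of letters does not change the operator, because \<open>f e\<close> maps the
  interval of r(e) into \<open>R e\<close>.\<close>

lemma gen_op_letter:
  fixes \<phi> :: "real \<Rightarrow> 'k::field"
  assumes "valid_gen E0 E1 g"
  shows "gen_op idx r R f g \<phi> = nf_op (nf_letter g) \<phi>"
  using assms
proof (cases rule: letter_cases)
  case 1
  then show ?thesis
    by (simp add: fun_eq_iff gen_op_def nf_op_def nf_letter_def)
next
  case (2 e)
  then show ?thesis
    by (simp add: fun_eq_iff gen_op_def nf_op_def nf_letter_GV_range f_in inv_f)
next
  case (3 v)
  then show ?thesis
    by (simp add: fun_eq_iff gen_op_def nf_op_def nf_letter_def)
next
  case (4 e)
  then show ?thesis
    using R_sub by (auto simp: fun_eq_iff gen_op_def nf_op_def nf_letter_def)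
next
  case (5 e)
  then show ?thesis
    by (simp add: fun_eq_iff gen_op_def nf_op_def nf_letter_def f_in)
qed

text \<open>Products declared \<open>Zero\<close> act as 0 because intervals of distinct vertices
  are disjoint.\<close>

lemma gen_op_act:
  fixes \<phi> :: "real \<Rightarrow> 'k::field"
  assumes g: "valid_gen E0 E1 g" and n: "nf_ok n"
  shows "gen_op idx r R f g (nf_op n \<phi>) = nf_op (nf_act g n) \<phi>"
proof (rule ext)
  fix x
  show "gen_op idx r R f g (nf_op n \<phi>) x = nf_op (nf_act g n) \<phi> x"
  proof (cases n)
    case Zero
    then show ?thesis by (cases g) (simp_all add: gen_op_def nf_op_def)
  next
    case (Vert v)
    then have v: "v \<in> E0" "v \<noteq> v0" "v \<notin> r ` E1"
      using n by (simp_all add: nf_ok_def)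
    show ?thesis
    proof (cases g)
      case (GV w)
      then show ?thesis
        using g v Vert Dint_disjoint[of w v x] by (auto simp: gen_op_def nf_op_def)
    next
      case (GE e)
      then have "x \<in> R e \<Longrightarrow> the_inv_into (D (r e)) (f e) x \<notin> D v"
        using g v inv_in[of e x] Dint_disjoint[of v "r e"] range_in by auto
      then show ?thesis
        using GE Vert by (simp add: gen_op_def nf_op_def)
    next
      case (GS e)
      then have "x \<in> D (r e) \<Longrightarrow> f e x \<notin> D v"
        using g v f_in[of e x] R_sub[of e] Dint_disjoint[of v v0] v0 by auto
      then show ?thesis
        using GS Vert by (simp add: gen_op_def nf_op_def)
    qed
  next
    case (Mon \<alpha> es \<beta>)
    then have \<alpha>: "set_option \<alpha> \<subseteq> E1"
      using n by (auto simp: nf_ok_def)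
    show ?thesis
    proof (cases g)
      case (GV v)
      then show ?thesis
        using g Mon Dint_disjoint[OF _ corner_in[OF \<alpha>], of v x] by (auto simp: gen_op_def nf_op_def)
    next
      case (GE e)
      then have e: "e \<in> E1" using g by simp
      show ?thesis
      proof (cases "\<alpha> = Some e")
        case True
        then show ?thesis
          using GE Mon e R_sub[OF e] inv_in[OF e] f_inv[OF e] by (auto simp: gen_op_def nf_op_def)
      next
        case False
        have "x \<in> R e \<Longrightarrow> the_inv_into (D (r e)) (f e) x \<notin> D (corner r v0 \<alpha>)"
          using inv_in[OF e] Dint_disjoint[OF range_in[OF e] corner_in[OF \<alpha>]]
            corner_eq_iff[of "Some e" \<alpha>] \<alpha> e False by auto
        then show ?thesis
          using GE Mon False by (simp add: gen_op_def nf_op_def)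
      qed
    next
      case (GS e)
      then have e: "e \<in> E1" using g by simp
      show ?thesis
      proof (cases "\<alpha> = None")
        case True
        then show ?thesis
          using GS Mon e R_sub[OF e] f_in[OF e, of x] by (auto simp: gen_op_def nf_op_def)
      next
        case False
        have "x \<in> D (r e) \<Longrightarrow> f e x \<notin> D (corner r v0 \<alpha>)"
          using f_in[OF e, of x] R_sub[OF e] Dint_disjoint[OF v0 corner_in[OF \<alpha>], of "f e x"]
            corner_eq_iff[of None \<alpha>] \<alpha> False by auto
        then show ?thesis
          using GS Mon False by (auto simp: gen_op_def nf_op_def)
      qed
    qed
  qed
qed

lemma word_op_nf:
  fixes \<phi> :: "real \<Rightarrow> 'k::field"
  shows "valid w \<Longrightarrow> w \<noteq> [] \<Longrightarrow> word_op idx r R f w \<phi> = nf_op (nf w) \<phi>"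
proof (induction w rule: nf.induct)
  case (2 g)
  then show ?case by (simp add: gen_op_letter)
next
  case (3 g h w)
  have "word_op idx r R f (g # h # w) \<phi> = gen_op idx r R f g (nf_op (nf (h # w)) \<phi>)"
    using 3 by simp
  also have "\<dots> = nf_op (nf (g # h # w)) \<phi>"
    using 3(2) nf_ok_nf[of "h # w"] by (simp add: gen_op_act)
  finally show ?case .
qed simp

text \<open>The classes of normal forms that point masses tell apart; the empty list is a
  placeholder for the forgotten projections.\<close>

fun shape :: "('a, 'b) nform \<Rightarrow> ('a, 'b) nform" where
  "shape (Mon \<alpha> es \<beta>) = Mon \<alpha> [] \<beta>"
| "shape n = n"

fun mid :: "('a, 'b) nform \<Rightarrow> 'b set" where
  "mid (Mon \<alpha> es \<beta>) = set es"
| "mid n = {}"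

lemma shape_cases:
  "shape n = Zero \<longleftrightarrow> n = Zero" "shape n = Vert v \<longleftrightarrow> n = Vert v"
  "shape n = Mon \<alpha> es \<beta> \<longleftrightarrow> es = [] \<and> (\<exists>es'. n = Mon \<alpha> es' \<beta>)"
  by (cases n; auto)+

text \<open>Apply the relation to the point mass at \<open>bwd \<beta> y\<close> and evaluate at
  \<open>bwd \<alpha> y\<close>. The interval of the evaluation point singles out \<alpha>, that of
  the mass singles out \<beta>, and the projections test \<open>y\<close>.\<close>

lemma shape_relation:
  fixes p :: "('a, 'b) gen list \<Rightarrow> 'k::field"
  assumes "finite W" "\<And>w. w \<in> W \<Longrightarrow> valid w"
    and zero: "\<And>\<phi> x. (\<Sum>w\<in>W. p w * nf_op (nf w) \<phi> x) = 0"
    and \<alpha>: "set_option \<alpha> \<subseteq> E1" and \<beta>: "set_option \<beta> \<subseteq> E1" and y: "y \<in> D v0"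
  shows "(\<Sum>w\<in>{w\<in>W. shape (nf w) = Mon \<alpha> [] \<beta>}.
    p w * (if \<forall>e\<in>mid (nf w). y \<in> R e then 1 else 0)) = 0"
proof (cases "\<forall>e\<in>set_option \<alpha> \<union> set_option \<beta>. y \<in> R e")
  case True
  define x where "x = bwd \<alpha> y"
  define \<phi> :: "real \<Rightarrow> 'k" where "\<phi> = (\<lambda>z. if z = bwd \<beta> y then 1 else 0)"
  have x: "x \<in> D (corner r v0 \<alpha>)" "fwd \<alpha> x = y" and z: "bwd \<beta> y \<in> D (corner r v0 \<beta>)"
    using True \<alpha> \<beta> y unfolding x_def by (auto intro: bwd_in fwd_bwd)
  have "nf_op (nf w) \<phi> x = (if shape (nf w) = Mon \<alpha> [] \<beta> \<and> (\<forall>e\<in>mid (nf w). y \<in> R e) then 1 else 0)"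
    if "w \<in> W" for w
  proof -
    have ok: "nf_ok (nf w)"
      using nf_ok_nf assms(2) that by blast
    show ?thesis
    proof (cases "nf w")
      case Zero
      then show ?thesis by (simp add: nf_op_def)
    next
      case (Vert v)
      then have "v \<in> E0" "v \<noteq> corner r v0 \<alpha>"
        using ok \<alpha> by (cases \<alpha>; auto simp: nf_ok_def)+
      then have "x \<notin> D v"
        using Dint_disjoint[OF _ corner_in[OF \<alpha>] _ x(1)] by blast
      then show ?thesis
        using Vert by (simp add: nf_op_def)
    next
      case (Mon \<alpha>' es \<beta>')
      have \<alpha>': "set_option \<alpha>' \<subseteq> E1" and \<beta>': "set_option \<beta>' \<subseteq> E1" "set_option \<beta>' \<subseteq> set es"
        using ok Mon by (auto simp: nf_ok_def)
      show ?thesis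
      proof (cases "\<alpha>' = \<alpha> \<and> (\<forall>e\<in>set es. y \<in> R e)")
        case T: True
        \<comment> \<open>By \<open>nf_ok\<close> the edge in \<beta>' is among the edges
          \<open>es\<close> whose sets contain \<open>y\<close>.\<close>
        have "bwd \<beta>' y \<in> D (corner r v0 \<beta>')"
          using T \<beta>' y by (intro bwd_in) auto
        then have "bwd \<beta>' y = bwd \<beta> y \<longleftrightarrow> \<beta>' = \<beta>"
          using Dint_disjoint[OF corner_in[OF \<beta>] corner_in[OF \<beta>'(1)] z] corner_eq_iff[OF \<beta> \<beta>'(1)]
          by auto
        then show ?thesis
          using T Mon x by (simp add: nf_op_def \<phi>_def)
      next
        case False
        then have "\<not> (x \<in> D (corner r v0 \<alpha>') \<and> (\<forall>e\<in>set es. fwd \<alpha>' x \<in> R e))"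
          using x(2) Dint_disjoint[OF corner_in[OF \<alpha>] corner_in[OF \<alpha>'] x(1)] corner_eq_iff[OF \<alpha> \<alpha>']
          by auto
        then show ?thesis
          using False Mon by (auto simp: nf_op_def)
      qed
    qed
  qed
  then have "(\<Sum>w\<in>W. p w * nf_op (nf w) \<phi> x) = (\<Sum>w\<in>W. if shape (nf w) = Mon \<alpha> [] \<beta>
      then p w * (if \<forall>e\<in>mid (nf w). y \<in> R e then 1 else 0) else 0)"
    by (intro sum.cong) auto
  then show ?thesis
    using zero assms(1) by (simp add: sum.inter_filter)
next
  case False
  \<comment> \<open>The outer edges belong to \<open>mid\<close>, so all indicators vanish at a
    point outside one of their sets.\<close>
  have "\<not> (\<forall>e\<in>mid (nf w). y \<in> R e)" if w: "w \<in> W" "shape (nf w) = Mon \<alpha> [] \<beta>" for w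
  proof -
    obtain es where "nf w = Mon \<alpha> es \<beta>"
      using w(2) by (auto simp: shape_cases)
    moreover have "nf_ok (nf w)"
      using nf_ok_nf assms(2) w(1) by blast
    ultimately show ?thesis
      using False by (auto simp: nf_ok_def)
  qed
  then show ?thesis
    by (intro sum.neutral) auto
qed

text \<open>Test with the constant 1 at the left end of the interval of \<open>v\<close>. Forms
  \<open>Mon\<close> live over \<open>v0\<close> or a range, and \<open>v\<close> is
  neither.\<close>

lemma vertex_relation:
  fixes p :: "('a, 'b) gen list \<Rightarrow> 'k::field"
  assumes "finite W" "\<And>w. w \<in> W \<Longrightarrow> valid w"
    and zero: "\<And>\<phi> x. (\<Sum>w\<in>W. p w * nf_op (nf w) \<phi> x) = 0"
    and v: "nf_ok (Vert v)"
  shows "(\<Sum>w\<in>{w\<in>W. nf w = Vert v}. p w) = 0"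
proof -
  define x where "x = real (idx v)"
  have x: "x \<in> D v" by (simp add: x_def Dint_def)
  have "nf_op (nf w) (\<lambda>_. 1 :: 'k) x = (if nf w = Vert v then 1 else 0)" if "w \<in> W" for w
  proof -
    have ok: "nf_ok (nf w)"
      using nf_ok_nf assms(2) that by blast
    show ?thesis
    proof (cases "nf w")
      case (Vert v')
      then have "x \<in> D v' \<longleftrightarrow> v' = v"
        using ok v x Dint_disjoint[of v' v x] by (auto simp only: nf_ok_def nform.case)
      then show ?thesis
        using Vert by (simp add: nf_op_def)
    next
      case (Mon \<alpha> es \<beta>)
      then have "set_option \<alpha> \<subseteq> E1" "corner r v0 \<alpha> \<noteq> v"
        using ok v by (cases \<alpha>; auto simp: nf_ok_def)+
      then have "x \<notin> D (corner r v0 \<alpha>)"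
        using Dint_disjoint[OF corner_in[of \<alpha>] _ _ x] v
        by (simp only: nf_ok_def nform.case) blast
      then show ?thesis
        using Mon by (simp add: nf_op_def)
    qed (simp add: nf_op_def)
  qed
  then have "(\<Sum>w\<in>W. p w * nf_op (nf w) (\<lambda>_. 1) x) = (\<Sum>w\<in>W. if nf w = Vert v then p w else 0)"
    by (intro sum.cong) auto
  then show ?thesis
    using zero assms(1) by (simp add: sum.inter_filter)
qed

text \<open>Operators and \<open>t\<close> both depend on a word only through its normal form. For
  each shape \<open>Mon\<close> the operator relation becomes a relation between indicator
  functions, which inclusion-exclusion transfers to \<open>t\<close>.\<close>

lemma operator_relation_imp_functional_relation:
  fixes p t :: "('a, 'b) gen list \<Rightarrow> 'k::field"
  assumes t: "star_functional E0 E1 r s C S v0 t"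
    and W: "finite W" "\<And>w. w \<in> W \<Longrightarrow> valid w \<and> w \<noteq> []"
    and zero: "\<And>\<phi> x. (\<Sum>w\<in>W. p w * word_op idx r R f w \<phi> x) = 0"
  shows "(\<Sum>w\<in>W. p w * t w) = 0"
proof -
  interpret F: star_functional E0 E1 r s C S v0 t by fact
  have valid: "\<And>w. w \<in> W \<Longrightarrow> valid w"
    using W(2) by blast
  have ok: "nf_ok (nf w)" if "w \<in> W" for w
    using that valid nf_ok_nf by blast
  have t_nf: "t w = F.nf_val [] (nf w)" if "w \<in> W" for w
    using F.nf_val_nf[of "[]" w] W(2)[OF that] by simp
  have zero': "(\<Sum>w\<in>W. p w * nf_op (nf w) \<phi> x) = 0" for \<phi> x
  proof -
    have "(\<Sum>w\<in>W. p w * nf_op (nf w) \<phi> x) = (\<Sum>w\<in>W. p w * word_op idx r R f w \<phi> x)"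
      by (rule sum.cong) (use W(2) in \<open>auto simp: word_op_nf\<close>)
    then show ?thesis using zero by simp
  qed
  have part: "(\<Sum>w\<in>{w\<in>W. shape (nf w) = k}. p w * t w) = 0" if k: "k \<in> (\<lambda>w. shape (nf w)) ` W" for k
  proof -
    obtain w0 where w0: "w0 \<in> W" "k = shape (nf w0)"
      using k by blast
    show ?thesis
    proof (cases "nf w0")
      case Zero
      then show ?thesis
        using w0 by (intro sum.neutral) (auto simp: shape_cases t_nf F.nf_val_def)
    next
      case (Vert v)
      \<comment> \<open>On a vertex class \<open>t\<close> is constant, so it suffices that the
        coefficients add up to 0.\<close>
      have "(\<Sum>w\<in>{w\<in>W. shape (nf w) = k}. p w * t w) = (\<Sum>w\<in>{w\<in>W. nf w = Vert v}. p w * t [GV v])"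
        using w0 Vert by (intro sum.cong) (auto simp: shape_cases t_nf F.nf_val_def)
      also have "\<dots> = 0"
        using vertex_relation[OF W(1) valid zero', of v] ok[OF w0(1)] Vert
        by (simp flip: sum_distrib_right)
      finally show ?thesis .
    next
      case (Mon \<alpha> es0 \<beta>)
      define u where "u = (star_part \<alpha> :: ('a, 'b) gen list)"
      define z where "z = (edge_part \<beta> :: ('a, 'b) gen list)"
      define W' where "W' = {w\<in>W. shape (nf w) = Mon \<alpha> [] \<beta>}"
      have \<alpha>: "set_option \<alpha> \<subseteq> E1" and \<beta>: "set_option \<beta> \<subseteq> E1"
        using ok[OF w0(1)] Mon by (auto simp: nf_ok_def)
      then have u: "valid u" and z: "valid z"
        by (simp_all only: u_def z_def F.valid_parts)
      have W': "finite (mid (nf w)) \<and> mid (nf w) \<subseteq> E1 \<and> t w = F.set_val u z (mid (nf w))"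
        if w: "w \<in> W'" for w
      proof -
        obtain es where es: "nf w = Mon \<alpha> es \<beta>" and "w \<in> W"
          using w by (auto simp: W'_def shape_cases)
        then have "set es \<subseteq> E1"
          using ok[of w] by (simp add: nf_ok_def)
        then show ?thesis
          using es t_nf[OF \<open>w \<in> W\<close>] F.set_val_set[OF u z]
          by (simp add: F.nf_val_def F.proj_val_def u_def z_def)
      qed
      have "(\<Sum>w\<in>W'. p w * F.set_val u z (mid (nf w))) = 0"
      proof (rule indicator_relation_imp_functional_relation[where D = "D v0" and R = R and E = E1 and C = C and S = S])
        show "(\<Sum>w\<in>W'. p w * (if \<forall>e\<in>mid (nf w). y \<in> R e then 1 else 0)) = 0" if "y \<in> D v0" for y
          unfolding W'_def using shape_relation[OF W(1) valid zero' \<alpha> \<beta> that] .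
      next
        show "finite W'"
          using W(1) by (simp add: W'_def)
      next
        show "finite (mid (nf w)) \<and> mid (nf w) \<subseteq> E1" if "w \<in> W'" for w
          using W'[OF that] by blast
      next
        fix A Y e e' assume "Y \<in> C" "e \<in> Y" "e' \<in> Y" "e \<noteq> e'" "{e, e'} \<subseteq> A"
        then show "F.set_val u z A = 0"
          by (rule F.set_val_orth[OF u z])
      next
        fix A X assume "X \<in> S"
        then show "F.set_val u z A = (\<Sum>e\<in>X. F.set_val u z (insert e A))"
          by (rule F.set_val_total[OF u z])
      qed (rule point)
      moreover have "k = Mon \<alpha> [] \<beta>"
        using w0 Mon by simp
      ultimately show ?thesis
        using W' by (simp flip: W'_def)
    qed
  qed
  have "(\<Sum>w\<in>W. p w * t w)
      = (\<Sum>k\<in>(\<lambda>w. shape (nf w)) ` W. \<Sum>w\<in>{w\<in>W. shape (nf w) = k}. p w * t w)"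
    by (rule sum.image_gen[OF W(1)])
  also have "\<dots> = 0"
    using part by (rule sum.neutral[OF ballI])
  finally show ?thesis .
qed

end

section \<open>Points of the branching system\<close>

lemma enum_index_downward: "n \<in> enum_index A \<Longrightarrow> m \<le> n \<Longrightarrow> m \<in> enum_index A"
  by (simp add: enum_index_def split: if_splits)

text \<open>Glues \<open>f e\<close>, which the construction prescribes piece by piece; disjoint
  targets give injectivity across pieces.\<close>

lemma bij_betw_Union_pieces:
  assumes g: "bij_betw g F G" and h: "\<And>K. K \<in> F \<Longrightarrow> bij_betw h K (g K)"
    and disj: "\<And>I J. I \<in> G \<Longrightarrow> J \<in> G \<Longrightarrow> I \<noteq> J \<Longrightarrow> I \<inter> J = {}"
  shows "bij_betw h (\<Union>F) (\<Union>G)"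
  unfolding bij_betw_def
proof
  show "inj_on h (\<Union>F)"
  proof (rule inj_onI)
    fix x y assume "x \<in> \<Union>F" "y \<in> \<Union>F" and eq: "h x = h y"
    then obtain K K' where K: "K \<in> F" "x \<in> K" "K' \<in> F" "y \<in> K'"
      by blast
    then have "h x \<in> g K" "h y \<in> g K'"
      using h by (meson bij_betwE)+
    moreover have "g K \<in> G" "g K' \<in> G"
      using K g by (meson bij_betwE)+
    ultimately have "g K = g K'"
      using disj eq by (metis disjoint_iff)
    then have "K = K'"
      using g K by (simp add: bij_betw_def inj_on_def)
    then show "x = y"
      using h[OF K(1)] K eq by (simp add: bij_betw_def inj_on_def)
  qed
  have "h ` \<Union>F = (\<Union>K\<in>F. h ` K)"
    by blast
  also have "\<dots> = (\<Union>K\<in>F. g K)"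
    using h by (simp add: bij_betw_def)
  also have "\<dots> = \<Union>G"
    using g by (simp add: bij_betw_def)
  finally show "h ` \<Union>F = \<Union>G" .
qed

context star_graph
begin

lemma star_rep_branching_construction:
  assumes bc: "branching_construction E0 E1 r s C S idx Ys P L R f"
  shows "star_rep E0 E1 r s C S v0 idx R f"
proof -
  define I where "I = enum_index (Cv C E1 s v0)"
  note bc1 = bc[unfolded branching_construction_def, THEN conjunct1]
  note bc2 = bc[unfolded branching_construction_def, THEN conjunct2, THEN bspec, OF v0, THEN mp, folded I_def]
  have inj_idx: "inj_on idx E0"
    using bc1 by (simp add: bij_betw_def)
  show ?thesis
  proof (cases "is_sink E1 s v0")
    case True
    then have "E1 = {}"
      using source by (auto simp: is_sink_def)
    \<comment> \<open>Without edges, \<open>point\<close> only asks for some point of the interval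
      of \<open>v0\<close>.\<close>
    moreover have "real (idx v0) \<in> Dint idx v0"
      by (simp add: Dint_def)
    ultimately show ?thesis
      by unfold_locales (use inj_idx in auto)
  next
    case False
    note bc3 = bc2[OF False]
    have Ys: "bij_betw (Ys v0) I (Cv C E1 s v0)"
      by (rule bc3[THEN conjunct1])
    note bc4 = bc3[THEN conjunct2]
    note Pn = bc4[THEN conjunct1, THEN bspec]
    note bc5 = bc4[THEN conjunct2]
    have L0: "bij_betw (L v0 0) (P v0 0) (tildeY S (Ys v0 0))"
      by (rule bc5[THEN conjunct1])
    note bc6 = bc5[THEN conjunct2]
    have LSuc: "bij_betw (L v0 (Suc n)) {J \<in> P v0 (Suc n). J \<subseteq> K} (tildeY S (Ys v0 (Suc n)))"
      if "Suc n \<in> I" "K \<in> P v0 n" for n K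
      by (rule bc6[THEN conjunct1, THEN spec, THEN mp, OF that(1), THEN conjunct2, THEN bspec,
            OF that(2), THEN conjunct2])
    note bc7 = bc6[THEN conjunct2, THEN bspec, THEN bspec]
    note R = bc7[THEN conjunct1] and f = bc7[THEN conjunct2]
    have Ys_in: "Ys v0 n \<in> C" if "n \<in> I" for n
      using bij_betwE[OF Ys] that by (simp add: Cv_def)
    have stage: "\<exists>n\<in>I. e \<in> Ys v0 n" if e: "e \<in> E1" for e
    proof -
      obtain Y where Y: "Y \<in> C" "e \<in> Y"
        using edge_in_C[OF e] by blast
      then have "Y \<in> Ys v0 ` I"
        using C_member(3) Ys by (simp add: bij_betw_def)
      then show ?thesis
        using Y by blast
    qed
    have P_disj: "J = K" if "n \<in> I" "J \<in> P v0 n" "K \<in> P v0 n" "y \<in> J" "y \<in> K" for n J K y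
      using Pn[OF that(1)] that unfolding interval_partition_def by blast
    show ?thesis
    proof unfold_locales
      show "inj_on idx E0" by (rule inj_idx)
    next
      fix e assume "e \<in> E1"
      then obtain n where n: "n \<in> I" "e \<in> Ys v0 n"
        using stage by blast
      have "\<Union>(P v0 n) = Dint idx v0"
        using Pn[OF n(1)] by (simp add: interval_partition_def)
      then show "R e \<subseteq> Dint idx v0"
        unfolding R[OF n] by blast
      obtain F g where F: "interval_partition F (Dint idx (r e))"
        "bij_betw g F {J \<in> P v0 n. L v0 n J = Some e}" "\<forall>K\<in>F. bij_betw (f e) K (g K)"
        using f[OF n] by blast
      have "bij_betw (f e) (\<Union>F) (\<Union>{J \<in> P v0 n. L v0 n J = Some e})"
        by (rule bij_betw_Union_pieces[OF F(2)]) (use F(3) P_disj[OF n(1)] in blast)+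
      moreover have "\<Union>F = Dint idx (r e)"
        using F(1) by (simp add: interval_partition_def)
      ultimately show "bij_betw (f e) (Dint idx (r e)) (R e)"
        unfolding R[OF n] by simp
    next
      fix A B assume fin: "finite A" "finite B" and AB: "A \<subseteq> E1" "B \<subseteq> E1" "A \<inter> B = {}"
        and orth: "\<forall>Y\<in>C. \<forall>e\<in>Y. \<forall>e'\<in>Y. e \<in> A \<and> e' \<in> A \<longrightarrow> e = e'"
        and nonfull: "\<forall>X\<in>S. \<not> X \<subseteq> B"
      \<comment> \<open>The label for stage \<open>n\<close>: the edge of \<open>A\<close> in the
        block if there is one, else an edge outside \<open>B\<close> if the block is in
        \<open>S\<close>, else the extra symbol.\<close>
      have "\<forall>n\<in>I. \<exists>a. a \<in> tildeY S (Ys v0 n) \<and> (\<forall>e\<in>A \<inter> Ys v0 n. a = Some e) \<and> (\<forall>e\<in>B. a \<noteq> Some e)"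
      proof
        fix n assume n: "n \<in> I"
        show "\<exists>a. a \<in> tildeY S (Ys v0 n) \<and> (\<forall>e\<in>A \<inter> Ys v0 n. a = Some e) \<and> (\<forall>e\<in>B. a \<noteq> Some e)"
        proof (cases "A \<inter> Ys v0 n = {}")
          case False
          then obtain e where e: "e \<in> A" "e \<in> Ys v0 n"
            by blast
          then have "Some e \<in> tildeY S (Ys v0 n)" "\<forall>e'\<in>A \<inter> Ys v0 n. e = e'" "\<forall>e'\<in>B. e \<noteq> e'"
            using orth Ys_in[OF n] AB(3) by (auto simp: tildeY_def)
          then show ?thesis
            by (intro exI[of _ "Some e"]) blast
        next
          case empty: True
          show ?thesis
          proof (cases "Ys v0 n \<in> S")
            case True
            then obtain e where "e \<in> Ys v0 n" "e \<notin> B"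
              using nonfull by blast
            then show ?thesis
              using empty by (intro exI[of _ "Some e"]) (auto simp: tildeY_def)
          next
            case False
            then show ?thesis
              using empty by (intro exI[of _ None]) (auto simp: tildeY_def)
          qed
        qed
      qed
      then obtain l where l: "\<And>n. n \<in> I \<Longrightarrow> l n \<in> tildeY S (Ys v0 n)"
        "\<And>n e. n \<in> I \<Longrightarrow> e \<in> A \<Longrightarrow> e \<in> Ys v0 n \<Longrightarrow> l n = Some e"
        "\<And>n e. n \<in> I \<Longrightarrow> e \<in> B \<Longrightarrow> l n \<noteq> Some e"
        by (auto dest!: bchoice)
      have down: "m \<in> I" if "n \<in> I" "m \<le> n" for m n
        using that enum_index_downward unfolding I_def by blast
      \<comment> \<open>Each interval of a stage contains a subinterval with any prescribed label of
        the next stage, so the labels \<open>l\<close> can be followed downwards.\<close>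
      have nested: "\<exists>J\<in>P v0 n. \<forall>m\<le>n. \<exists>K\<in>P v0 m. J \<subseteq> K \<and> L v0 m K = l m" if "n \<in> I" for n
        using that
      proof (induction n)
        case 0
        then have "l 0 \<in> L v0 0 ` P v0 0"
          using L0 l(1) by (simp add: bij_betw_def)
        then obtain J where "J \<in> P v0 0" "L v0 0 J = l 0"
          by auto
        then show ?case
          by (intro bexI[of _ J]) auto
      next
        case (Suc n)
        then obtain J where J: "J \<in> P v0 n" "\<forall>m\<le>n. \<exists>K\<in>P v0 m. J \<subseteq> K \<and> L v0 m K = l m"
          using down[of "Suc n" n] by auto
        have "l (Suc n) \<in> L v0 (Suc n) ` {J' \<in> P v0 (Suc n). J' \<subseteq> J}"
          using LSuc[OF Suc.prems J(1)] l(1)[OF Suc.prems] by (simp add: bij_betw_def)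
        then obtain J' where J': "J' \<in> P v0 (Suc n)" "J' \<subseteq> J" "L v0 (Suc n) J' = l (Suc n)"
          by auto
        have "\<exists>K\<in>P v0 m. J' \<subseteq> K \<and> L v0 m K = l m" if "m \<le> Suc n" for m
        proof (cases "m \<le> n")
          case True
          then obtain K where "K \<in> P v0 m" "J \<subseteq> K" "L v0 m K = l m"
            using J(2) by auto
          then show ?thesis
            using J'(2) by (intro bexI[of _ K]) auto
        next
          case False
          then show ?thesis using J' that by (auto simp: le_Suc_eq)
        qed
        then show ?case
          using J'(1) by blast
      qed
      \<comment> \<open>Finitely many edges involve finitely many stages, so an interval of one late
        stage decides them all and no limit is taken.\<close>
      have "\<forall>e\<in>A \<union> B. \<exists>n. n \<in> I \<and> e \<in> Ys v0 n"
        using stage AB(1,2) by blast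
      from bchoice[OF this] obtain st where st: "\<forall>e\<in>A \<union> B. st e \<in> I \<and> e \<in> Ys v0 (st e)" ..
      have "I \<noteq> {}"
        using False stage by (auto simp: is_sink_def)
      then have "0 \<in> I"
        using down by blast
      \<comment> \<open>The inserted 0 covers the case without edges in \<open>A\<close> and
        \<open>B\<close>; it is a stage because \<open>v0\<close> emits an edge.\<close>
      define N where "N = Max (insert 0 (st ` (A \<union> B)))"
      have "N \<in> insert 0 (st ` (A \<union> B))"
        unfolding N_def using fin by (intro Max_in) auto
      then have N: "N \<in> I"
        using \<open>0 \<in> I\<close> st by blast
      have st_le: "st e \<le> N" if "e \<in> A \<union> B" for e
        unfolding N_def using fin that by (intro Max_ge) auto
      obtain J where J: "J \<in> P v0 N" "\<And>m. m \<le> N \<Longrightarrow> \<exists>K\<in>P v0 m. J \<subseteq> K \<and> L v0 m K = l m"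
        using nested[OF N] by blast
      have "\<exists>a b. a < b \<and> J = {a..<b}"
        using Pn[OF N] J(1) by (simp add: interval_partition_def)
      then obtain a b where "a < b" "J = {a..<b}"
        by (elim exE conjE)
      then have a: "a \<in> J"
        by simp
      have "\<Union>(P v0 N) = Dint idx v0"
        using Pn[OF N] by (simp add: interval_partition_def)
      then have "a \<in> Dint idx v0"
        using a J(1) by blast
      moreover have "a \<in> R e" if e: "e \<in> A" for e
      proof -
        have n: "st e \<in> I" "e \<in> Ys v0 (st e)" "st e \<le> N"
          using st st_le e by auto
        obtain K where "K \<in> P v0 (st e)" "a \<in> K" "L v0 (st e) K = Some e"
          using J(2)[OF n(3)] a l(2)[OF n(1) e n(2)] by auto
        then show ?thesis
          unfolding R[OF n(1,2)] by blast
      qed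
      moreover have "a \<notin> R e" if e: "e \<in> B" for e
      proof
        assume aR: "a \<in> R e"
        have n: "st e \<in> I" "e \<in> Ys v0 (st e)" "st e \<le> N"
          using st st_le e by auto
        obtain K where K: "K \<in> P v0 (st e)" "a \<in> K" "L v0 (st e) K = l (st e)"
          using J(2)[OF n(3)] a by auto
        obtain K' where K': "K' \<in> P v0 (st e)" "a \<in> K'" "L v0 (st e) K' = Some e"
          using aR unfolding R[OF n(1,2)] by blast
        \<comment> \<open>A point has one label per stage, and the label followed here avoids
          \<open>B\<close>.\<close>
        have "K' = K"
          by (rule P_disj[OF n(1) K'(1) K(1) K'(2) K(2)])
        then show False
          using K K' l(3)[OF n(1) e] by simp
      qed
      ultimately show "\<exists>y\<in>Dint idx v0. (\<forall>e\<in>A. y \<in> R e) \<and> (\<forall>e\<in>B. y \<notin> R e)"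
        by blast
    qed
  qed
qed

section \<open>Functionals vanishing on the ideal, and faithfulness\<close>

lemma star_functional_of_linear:
  fixes T :: "(('v, 'e) gen list \<Rightarrow> 'k::field) \<Rightarrow> 'k"
  assumes add: "\<And>p q. T (\<lambda>w. p w + q w) = T p + T q" and smult: "\<And>c p. T (\<lambda>w. c * p w) = c * T p"
    and ideal: "\<And>q. q \<in> fa_ideal E0 E1 (AL_rels E0 E1 r s C S) \<Longrightarrow> T q = 0"
  shows "star_functional E0 E1 r s C S v0 (\<lambda>w. T (fa_word w))"
proof -
  let ?AL = "AL_rels E0 E1 r s C S :: (('v, 'e) gen list \<Rightarrow> 'k) set"
  have minus: "T (fa_minus p q) = T p - T q" for p q
    using add[of p "\<lambda>w. -1 * q w"] smult[of "-1" q] by (simp add: fa_minus_def)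
  have T0: "T (\<lambda>_. 0) = 0"
    using smult[of 0 "\<lambda>_. 0"] by simp
  have sum: "T (\<lambda>w. \<Sum>i\<in>X. F i w) = (\<Sum>i\<in>X. T (F i))"
    for X :: "'e set" and F :: "'e \<Rightarrow> ('v, 'e) gen list \<Rightarrow> 'k"
    by (induction X rule: infinite_finite_induct) (simp_all add: add T0)
  \<comment> \<open>Every relation required of \<open>t\<close> is \<open>T\<close> applied to a
    generator of the ideal, expanded into words.\<close>
  have mult: "T (fa_mult (fa_mult (fa_word u) x) (fa_word w)) = 0"
    if "x \<in> ?AL" "valid u" "valid w" for x u w
    using that by (intro ideal fa_ideal.gen)
  have eq: "T (fa_word (u @ a @ w)) = T (fa_word (u @ b @ w))"
    if "fa_minus (fa_word a) (fa_word b) \<in> ?AL" "valid u" "valid w" for a b u w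
    using mult[OF that] by (simp add: fa_mult_expand minus)
  show ?thesis
  proof unfold_locales
    fix u w :: "('v, 'e) gen list" assume u: "valid u" and w: "valid w"
    show "T (fa_word (u @ GV v # GV v # w)) = T (fa_word (u @ GV v # w))" if "v \<in> E0" for v
      using that eq[of "[GV v, GV v]" "[GV v]", OF _ u w] by (simp add: AL_rels_def CL_rels_def) blast
    show "T (fa_word (u @ GV v # GV v' # w)) = 0" if "v \<in> E0" "v' \<in> E0" "v \<noteq> v'" for v v'
      using that mult[of "fa_word [GV v, GV v']", OF _ u w]
      by (simp add: AL_rels_def CL_rels_def fa_mult_expand) blast
    {
      fix e assume e: "e \<in> E1"
      show "T (fa_word (u @ GV v0 # GE e # w)) = T (fa_word (u @ GE e # w))"
        using e source[OF e] eq[of "[GV (s e), GE e]" "[GE e]", OF _ u w]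
        by (simp add: AL_rels_def CL_rels_def) blast
      show "T (fa_word (u @ GE e # GV (r e) # w)) = T (fa_word (u @ GE e # w))"
        using e eq[of "[GE e, GV (r e)]" "[GE e]", OF _ u w]
        by (simp add: AL_rels_def CL_rels_def) blast
      show "T (fa_word (u @ GV (r e) # GS e # w)) = T (fa_word (u @ GS e # w))"
        using e eq[of "[GV (r e), GS e]" "[GS e]", OF _ u w]
        by (simp add: AL_rels_def CL_rels_def) blast
      show "T (fa_word (u @ GS e # GV v0 # w)) = T (fa_word (u @ GS e # w))"
        using e source[OF e] eq[of "[GS e, GV (s e)]" "[GS e]", OF _ u w]
        by (simp add: AL_rels_def CL_rels_def) blast
      \<comment> \<open>The relation for e^* e is imposed blockwise, so a block containing
        \<open>e\<close> is needed to invoke it.\<close>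
      obtain Y where "Y \<in> C" "e \<in> Y"
        using edge_in_C[OF e] by blast
      then have "fa_minus (fa_word [GS e, GE e]) (if e = e then fa_word [GV (r e)] else (\<lambda>_. 0))
          \<in> ?AL"
        unfolding AL_rels_def CL_rels_def by blast
      then show "T (fa_word (u @ GS e # GE e # w)) = T (fa_word (u @ GV (r e) # w))"
        using eq[of "[GS e, GE e]" "[GV (r e)]", OF _ u w] by simp
    }
    show "T (fa_word (u @ GS e # GE e' # w)) = 0" if "Y \<in> C" "e \<in> Y" "e' \<in> Y" "e \<noteq> e'" for Y e e'
    proof -
      have "fa_minus (fa_word [GS e, GE e']) (if e = e' then fa_word [GV (r e)] else (\<lambda>_. 0))
          \<in> ?AL"
        unfolding AL_rels_def CL_rels_def using that by blast
      from mult[OF this u w] show ?thesis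
        using that by (simp add: fa_mult_expand minus T0)
    qed
    show "T (fa_word (u @ GV v0 # w)) = (\<Sum>e\<in>X. T (fa_word (u @ GE e # GS e # w)))" if "X \<in> S" for X
    proof -
      have "fa_minus (fa_word [GV v0]) (\<lambda>w. \<Sum>e\<in>X. fa_word [GE e, GS e] w) \<in> ?AL"
        unfolding AL_rels_def CL_rels_def using that v0 C_member[of X] S_member[of X] by blast
      from mult[OF this u w] show ?thesis
        by (simp add: fa_mult_expand minus sum)
    qed
    show "T (fa_word (u @ GE e # GS e # GE e' # GS e' # w))
        = T (fa_word (u @ GE e' # GS e' # GE e # GS e # w))" if e: "e \<in> E1" "e' \<in> E1" for e e'
    proof -
      \<comment> \<open>The one-letter path \<open>e\<close> yields the projection e e^* as its
        product with its adjoint.\<close>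
      have "path_word E1 [GE e :: ('v, 'e) gen]" "path_word E1 [GE e' :: ('v, 'e) gen]"
        using e by (simp_all add: path_word_def)
      then have "fa_minus (fa_word ([GE e] @ word_star [GE e] @ [GE e'] @ word_star [GE e']))
          (fa_word ([GE e'] @ word_star [GE e'] @ [GE e] @ word_star [GE e])) \<in> ?AL"
        unfolding AL_rels_def comm_rels_def by blast
      from eq[OF this u w] show ?thesis
        by (simp add: word_star_def)
    qed
  qed
qed

end

theorem theorem4p3:
  fixes E0 :: "'v set" and E1 :: "'e set" and r s :: "'e \<Rightarrow> 'v"
    and C S :: "'e set set" and v0 :: 'v
    and idx :: "'v \<Rightarrow> nat" and Ys :: "'v \<Rightarrow> nat \<Rightarrow> 'e set"
    and P :: "'v \<Rightarrow> nat \<Rightarrow> real set set" and L :: "'v \<Rightarrow> nat \<Rightarrow> real set \<Rightarrow> 'e option"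
    and R :: "'e \<Rightarrow> real set" and f :: "'e \<Rightarrow> real \<Rightarrow> real"
  assumes "separated_graph E0 E1 r s C"
    and "countable E0" and "countable E1"
    and "v0 \<in> E0" and "\<forall>e\<in>E1. s e = v0"
    and "inj_on r E1"
    and "\<forall>e\<in>E1. r e \<noteq> s e"
    and "S \<subseteq> C_fin C"
    and "branching_construction E0 E1 r s C S idx Ys P L R f"
  shows "faithful_on_AL E0 E1 r s C S idx R f TYPE('k::field)"
  unfolding faithful_on_AL_def
proof (intro allI impI, rule ccontr)
  fix p :: "('v, 'e) gen list \<Rightarrow> 'k"
  assume p: "p \<in> free_alg E0 E1" and rep: "\<forall>\<phi> x. rep idx r R f p \<phi> x = 0"
    and notin: "p \<notin> fa_ideal E0 E1 (AL_rels E0 E1 r s C S)"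
  interpret star_graph E0 E1 r s C S v0
    by unfold_locales (use assms(1,4-8) in auto)
  interpret star_rep E0 E1 r s C S v0 idx R f
    by (rule star_rep_branching_construction) (rule assms)
  show False
  proof (rule separating_functional[OF fa_ideal.zero _ _ notin])
    fix T :: "(('v, 'e) gen list \<Rightarrow> 'k) \<Rightarrow> 'k"
    assume add: "\<And>p q. T (\<lambda>w. p w + q w) = T p + T q"
      and smult: "\<And>c p. T (\<lambda>w. c * p w) = c * T p"
      and ideal: "\<And>q. q \<in> fa_ideal E0 E1 (AL_rels E0 E1 r s C S) \<Longrightarrow> T q = 0" and "T p \<noteq> 0"
    define W where "W = {w. p w \<noteq> 0}"
    have W: "finite W" "\<And>w. w \<in> W \<Longrightarrow> valid w \<and> w \<noteq> []"
      using p by (auto simp: free_alg_def W_def)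
    have "(\<Sum>w\<in>W. p w * T (fa_word w)) = 0"
      by (rule operator_relation_imp_functional_relation[OF star_functional_of_linear[OF add smult ideal] W])
        (use rep in \<open>simp_all add: rep_def W_def\<close>)
    moreover have "T p = (\<Sum>w\<in>W. p w * T (fa_word w))"
    proof -
      have "T (\<lambda>_. 0) = 0"
        using smult[of 0 "\<lambda>_. 0"] by simp
      then have sum: "T (\<lambda>u. \<Sum>w\<in>V. p w * fa_word w u) = (\<Sum>w\<in>V. p w * T (fa_word w))" for V
        by (induction V rule: infinite_finite_induct) (simp_all add: add smult)
      have "p = (\<lambda>u. \<Sum>w\<in>W. p w * fa_word w u)"
        using W(1) by (auto simp: fun_eq_iff fa_word_def W_def if_distrib cong: if_cong)
      then have "T p = T (\<lambda>u. \<Sum>w\<in>W. p w * fa_word w u)"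
        by (rule arg_cong)
      also have "\<dots> = (\<Sum>w\<in>W. p w * T (fa_word w))"
        by (rule sum)
      finally show ?thesis .
    qed
    ultimately show False
      using \<open>T p \<noteq> 0\<close> by simp
  qed (erule (1) fa_ideal.add | erule fa_ideal.smult)+
qed

end
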